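(* There is an $O(1)$-approximation algorithm in the Congested Clique model, in the explicit metric setting, for Facility Location with Penalties, running in $O(\log\log\log n)$ rounds with high probability.
   Context: Facility Location with Penalties: the input is a set $F$ of facilities with opening costs $f_i\ge 0$, a set $C$ of clients with penalties $p_j\ge 0$, and a metric $d$ on $F\cup C$. A solution is $(C',F')$ with $C'\subseteq C$, $F'\subseteq F$; its cost is $\sum_{i\in F'}f_i+\sum_{j\in C'}d(j,F')+\sum_{j\in C\setminus C'}p_j$, with $d(j,F')=\min_{i\in F'}d(i,j)$ and $d(j,\emptyset)=+\infty$. An $\alpha$-approximation algorithm outputs a solution of cost at most $\alpha$ times the minimum cost. Assume $|F|=|C|=n$ and that every individual number in the input can be represented in $O(\log n)$ bits. Congested Clique model: the communication network is a clique with $|F|+|C|$ nodes, each node hosting one facility or client. In each synchronous round each node performs local computation and sends a (possibly distinct) $O(\log n)$-bit message to each other node. Initially the node hosting a vertex knows its opening cost (facility) or penalty (client). Explicit metric setting: the node hosting a vertex $v\in F\cup C$ initially knows $d(u,v)$ for all $u\in F\cup C$. The algorithm is randomized; "with high probability" means with probability at least $1-1/\mathrm{poly}(n)$. *)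

theory Defs
  imports "HOL-Probability.Probability" "HOL-Library.Landau_Symbols"
begin

section \<open>Facility Location with Penalties\<close>

record flp =
  facilities :: "nat set"
  clients :: "nat set"
  opening_cost :: "nat \<Rightarrow> real"
  penalty :: "nat \<Rightarrow> real"
  distance :: "nat \<Rightarrow> nat \<Rightarrow> real"

text \<open>
  The points of \<open>F \<union> C\<close> are named by natural numbers below \<open>2 n\<close>, which is always possible
  because \<open>F \<union> C\<close> has at most \<open>2 n\<close> elements; thus names fit into \<open>O(log n)\<close> bits.
  The sets \<open>F\<close> and \<open>C\<close> may overlap, so a client may be located at a facility.
\<close>
definition flp_instance :: "nat \<Rightarrow> flp \<Rightarrow> bool" where
  "flp_instance n I \<longleftrightarrow>
     facilities I \<subseteq> {..<2 * n} \<and> clients I \<subseteq> {..<2 * n} \<and>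
     card (facilities I) = n \<and> card (clients I) = n \<and>
     (\<forall>i\<in>facilities I. 0 \<le> opening_cost I i) \<and>
     (\<forall>j\<in>clients I. 0 \<le> penalty I j) \<and>
     Metric_space (facilities I \<union> clients I) (distance I)"

text \<open>
  All numbers of the input have a representation by at most \<open>k\<close> bits under the number
  format \<open>dec\<close> (which maps a bit string to the number it represents).
\<close>
definition numbers_representable :: "(bool list \<Rightarrow> real) \<Rightarrow> nat \<Rightarrow> flp \<Rightarrow> bool" where
  "numbers_representable dec k I \<longleftrightarrow>
     opening_cost I ` facilities I \<union> penalty I ` clients I \<union>
     {distance I u v | u v. u \<in> facilities I \<union> clients I \<and> v \<in> facilities I \<union> clients I}
       \<subseteq> dec ` {w. length w \<le> k}"

text \<open>The infimum over the empty set is \<open>\<infinity>\<close>, as required for \<open>d(j, {})\<close>.\<close>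
definition dist_to_set :: "flp \<Rightarrow> nat \<Rightarrow> nat set \<Rightarrow> ereal" where
  "dist_to_set I j F' = (INF i\<in>F'. ereal (distance I i j))"

definition cost :: "flp \<Rightarrow> nat set \<times> nat set \<Rightarrow> ereal" where
  "cost I = (\<lambda>(C', F').
     (\<Sum>i\<in>F'. ereal (opening_cost I i)) + (\<Sum>j\<in>C'. dist_to_set I j F')
       + (\<Sum>j\<in>clients I - C'. ereal (penalty I j)))"

definition min_cost :: "flp \<Rightarrow> ereal" where
  "min_cost I = Min (cost I ` (Pow (clients I) \<times> Pow (facilities I)))"


section \<open>The Congested Clique\<close>

text \<open>
  \<open>Inl i\<close> is the node hosting facility \<open>i\<close>, and \<open>Inr j\<close> the node hosting client \<open>j\<close>.
\<close>
type_synonym node = "nat + nat"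

definition nodes :: "flp \<Rightarrow> node set" where
  "nodes I = facilities I <+> clients I"

text \<open>
  What a node knows initially in the explicit metric setting: its own identity, the names of
  the nodes of the network, its opening cost or penalty, and its row of the distance matrix.
\<close>
record view =
  self :: node
  all_facilities :: "nat set"
  all_clients :: "nat set"
  weight :: real
  row :: "nat \<Rightarrow> real"

definition initial_view :: "flp \<Rightarrow> node \<Rightarrow> view" where
  "initial_view I v =
     \<lparr> self = v,
       all_facilities = facilities I,
       all_clients = clients I,
       weight = (case v of Inl i \<Rightarrow> opening_cost I i | Inr j \<Rightarrow> penalty I j),
       row = restrict (\<lambda>u. distance I u (case v of Inl i \<Rightarrow> i | Inr j \<Rightarrow> j))
               (facilities I \<union> clients I) \<rparr>"

type_synonym message = "bool list"

text \<open>Element \<open>t\<close> of a history maps each sender to its message received in round \<open>t\<close>.\<close>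
type_synonym history = "(node \<Rightarrow> message) list"

text \<open>
  Local computation is unrestricted, so without loss of generality a node remembers everything:
  its actions are functions of its initial knowledge, the private coins it has tossed so far,
  and the messages it has received so far. After \<open>t\<close> rounds a node has tossed the first
  \<open>tosses A V t\<close> coins of its random tape. The value \<open>None\<close> of \<open>decide\<close> means that the
  node continues. A facility outputs whether it is opened, a client whether it belongs to the
  set of served clients.
\<close>
record algorithm =
  tosses :: "view \<Rightarrow> nat \<Rightarrow> nat"
  send :: "view \<Rightarrow> bool list \<Rightarrow> history \<Rightarrow> node \<Rightarrow> message"
  decide :: "view \<Rightarrow> bool list \<Rightarrow> history \<Rightarrow> bool option"

definition coins :: "algorithm \<Rightarrow> view \<Rightarrow> bool stream \<Rightarrow> history \<Rightarrow> bool list" where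
  "coins A V r h = stake (tosses A V (length h)) r"

text \<open>
  The configuration of a node is its history and its output so far. A node halts as soon as it
  has an output: the output is final, and the node is silent from then on.
\<close>
type_synonym config = "history \<times> bool option"

definition message_to ::
  "algorithm \<Rightarrow> flp \<Rightarrow> (node \<Rightarrow> bool stream) \<Rightarrow> (node \<Rightarrow> config) \<Rightarrow> node \<Rightarrow> node \<Rightarrow> message" where
  "message_to A I \<omega> c u v =
     (let V = initial_view I u; h = fst (c u) in
      if u \<in> nodes I \<and> u \<noteq> v \<and> snd (c u) = None then send A V (coins A V (\<omega> u) h) h v else [])"

definition decision ::
  "algorithm \<Rightarrow> flp \<Rightarrow> (node \<Rightarrow> bool stream) \<Rightarrow> history \<Rightarrow> node \<Rightarrow> bool option" where
  "decision A I \<omega> h v = (let V = initial_view I v in decide A V (coins A V (\<omega> v) h) h)"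

primrec run :: "algorithm \<Rightarrow> flp \<Rightarrow> (node \<Rightarrow> bool stream) \<Rightarrow> nat \<Rightarrow> node \<Rightarrow> config" where
  "run A I \<omega> 0 = (\<lambda>v. ([], decision A I \<omega> [] v))"
| "run A I \<omega> (Suc t) = (\<lambda>v.
     let c = run A I \<omega> t;
         h = fst (c v) @ [\<lambda>u. message_to A I \<omega> c u v]
     in (h, case snd (c v) of Some b \<Rightarrow> Some b | None \<Rightarrow> decision A I \<omega> h v))"

definition bandwidth_at_most :: "algorithm \<Rightarrow> flp \<Rightarrow> nat \<Rightarrow> bool" where
  "bandwidth_at_most A I B \<longleftrightarrow>
     (\<forall>\<omega> t. \<forall>u\<in>nodes I. \<forall>v\<in>nodes I. length (message_to A I \<omega> (run A I \<omega> t) u v) \<le> B)"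

definition halted :: "algorithm \<Rightarrow> flp \<Rightarrow> (node \<Rightarrow> bool stream) \<Rightarrow> nat \<Rightarrow> bool" where
  "halted A I \<omega> t \<longleftrightarrow> (\<forall>v\<in>nodes I. snd (run A I \<omega> t v) \<noteq> None)"

definition solution ::
  "algorithm \<Rightarrow> flp \<Rightarrow> (node \<Rightarrow> bool stream) \<Rightarrow> nat \<Rightarrow> nat set \<times> nat set" where
  "solution A I \<omega> t =
     ({j \<in> clients I. snd (run A I \<omega> t (Inr j)) = Some True},
      {i \<in> facilities I. snd (run A I \<omega> t (Inl i)) = Some True})"

text \<open>Every node has a private random tape of independent fair coin tosses.\<close>
definition tapes :: "flp \<Rightarrow> (node \<Rightarrow> bool stream) measure" where
  "tapes I = PiM (nodes I) (\<lambda>_. stream_space (measure_pmf (bernoulli_pmf (1 / 2))))"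

text \<open>
  The approximation guarantee holds almost surely; only the running time is subject to the
  probability bound. As outputs are final, the solution does not depend on the time \<open>t\<close>.
\<close>
definition approximates :: "algorithm \<Rightarrow> flp \<Rightarrow> real \<Rightarrow> bool" where
  "approximates A I \<alpha> \<longleftrightarrow>
     (AE \<omega> in tapes I. \<exists>t. halted A I \<omega> t \<and> cost I (solution A I \<omega> t) \<le> ereal \<alpha> * min_cost I)"

end

theory Submission
  imports Defs "HOL-Real_Asymp.Real_Asymp"
begin

text \<open>
  Following Mettu and Plaxton, the radius of a facility \<open>i\<close> is, up to a factor of 2, the \<open>r\<close> with
  \<open>(\<Sum>j. max 0 (min (p j) r - d i j)) = f i\<close>. A facility is eligible if no facility of smaller
  radius is within twice its radius, so that eligible facilities with intersecting balls have equal
  radii. Let \<open>G\<close> join eligible facilities of equal radius \<open>\<rho>\<close> at distance at most \<open>2 \<rho>\<close>. An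
  independent set of \<open>G\<close> that meets every ball of radius \<open>10 \<rho>\<close> around an eligible facility is a
  45-approximation.

  To find such a set in a constant number of rounds, sample each vertex of \<open>G\<close> with probability
  about \<open>1 / sqrt deg\<close> and add the vertices with no sampled vertex within \<open>8 \<rho>\<close>. The expected
  number of edges among the resulting vertices is linear, so that all of them can be announced to
  everybody, and everybody can compute the same maximal independent set.

  Randomness is eliminated: some family of \<open>n\<^sup>3\<close> samples has a linear average number of edges for all
  graphs simultaneously, and a sample at most as bad as the average is selected in three
  stages, each of which compares the averages of \<open>n\<close> subfamilies at \<open>n\<close> different nodes.
\<close>

section \<open>Sparsification of graphs\<close>

text \<open>\<open>G\<close> may have quadratically many edges, too many for everybody to learn in a
  constant number of rounds. With probability \<open>1 / sqrt deg\<close>, an edge between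
  \<open>u\<close> and \<open>v\<close> survives inside the sample with probability of order
  \<open>1 / sqrt (deg u * deg v)\<close>, which is at most \<open>1 / deg u + 1 / deg v\<close> and
  so sums to a linear amount. The distance \<open>8 \<rho>\<close> is four steps of
  \<open>G\<close>, the length of the walks in the charging argument for uncovered vertices.

  A random sample obeys the linear bound only on average, but messages of bounded length need it for
  the very sample in use, and the approximation has to hold almost surely. A load is of order at
  most \<open>n^2\<close>, its mean of order \<open>n\<close>, and there are
  \<open>2 ^ O(n^2)\<close> graphs; the exponential moment argument then asks for about
  \<open>n^3\<close> samples. As \<open>n\<close> nodes compare only \<open>n\<close> averages at a
  time, this makes three stages.

  The distance \<open>10 \<rho>\<close> is \<open>8 \<rho>\<close> to a surviving vertex plus
  \<open>2 \<rho>\<close> to the independent set. The ratio is \<open>45 = 3 * (1 + 4 + 10)\<close>: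
  3 for the lower bound on the optimum, 1 for opening, 4 for reaching an eligible facility and 10
  for reaching an opened one.\<close>

definition threshold :: "nat \<Rightarrow> nat \<Rightarrow> nat" where
  "threshold m d = nat \<lceil>real m / sqrt (real d)\<rceil>"

text \<open>A random sample is encoded by a function \<open>g\<close> with values below
  \<open>m\<close>: a vertex of degree \<open>d\<close> is selected by \<open>threshold m d\<close>
  of the \<open>m\<close> values. The sample space is finite, and probabilities become
  cardinalities.\<close>

definition sample :: "nat \<Rightarrow> nat set \<Rightarrow> (nat \<Rightarrow> nat) \<Rightarrow> (nat \<Rightarrow> nat) \<Rightarrow> nat set" where
  "sample m E deg g = {u \<in> E. g u < threshold m (deg u)}"

text \<open>Bounds the edges that vertex \<open>i\<close>, with neighbours \<open>A\<close> and ball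
  \<open>B\<close>, brings into the sparsified graph: a sampled vertex meets only sampled neighbours
  there, an uncovered one is charged its full degree, and any other vertex is dropped.\<close>

definition load :: "nat set \<Rightarrow> nat set \<Rightarrow> nat set \<Rightarrow> nat \<Rightarrow> nat" where
  "load A B X i = (if i \<in> X then card (A \<inter> X) else if B \<inter> X = {} then card A else 0)"

definition total_load :: "nat \<Rightarrow> nat rel \<Rightarrow> nat rel \<Rightarrow> (nat \<Rightarrow> nat) \<Rightarrow> nat" where
  "total_load m N H g = (\<Sum>i\<in>Domain N. load (N `` {i}) (H `` {i})
     (sample m (Domain N) (\<lambda>u. card (N `` {u})) g) i)"

text \<open>\<open>N\<close> stands for \<open>G\<close> with loops and \<open>H\<close> for the
  balls of radius \<open>8 \<rho>\<close>, of which little more than the inclusion of four-step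
  walks is kept. There are infinitely many metrics but only finitely many such pairs for each
  \<open>m\<close>, so a union bound is possible.\<close>

definition graph_pair :: "nat \<Rightarrow> nat rel \<Rightarrow> nat rel \<Rightarrow> bool" where
  "graph_pair m N H \<longleftrightarrow> N \<subseteq> {..<m} \<times> {..<m} \<and> sym N \<and> (\<forall>i\<in>Domain N. (i, i) \<in> N) \<and>
     H \<subseteq> Domain N \<times> Domain N \<and> N O N O N O N \<subseteq> H"

text \<open>Rounding up at most doubles the probability, since \<open>d \<le> m\<close> gives
  \<open>1 \<le> m / sqrt d\<close>.\<close>

lemma threshold_bounds:
  assumes "1 \<le> d" "d \<le> m"
  shows "1 / sqrt (real d) \<le> real (threshold m d) / real m"
    and "real (threshold m d) / real m \<le> 2 / sqrt (real d)"
    and "threshold m d \<le> m"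
proof -
  have m: "0 < real m" and d: "0 < sqrt (real d)" "1 \<le> sqrt (real d)" using assms by auto
  have sm: "sqrt (real d) \<le> real m"
  proof -
    have "sqrt (real d) \<le> sqrt (real d) * sqrt (real d)"
      using mult_left_mono[OF d(2), of "sqrt (real d)"] d(1) by simp
    also have "\<dots> = real d" by simp
    also have "\<dots> \<le> real m" using assms by simp
    finally show ?thesis .
  qed
  define x where "x = real m / sqrt (real d)"
  have x1: "1 \<le> x" using sm d by (simp add: x_def field_simps)
  have t: "real (threshold m d) = of_int \<lceil>x\<rceil>" using x1 by (simp add: threshold_def x_def)
  have "x \<le> real (threshold m d)" using t by simp
  then show "1 / sqrt (real d) \<le> real (threshold m d) / real m"
    using m d by (simp add: x_def field_simps)
  have "real (threshold m d) \<le> 2 * x" using t x1 by linarith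
  then show "real (threshold m d) / real m \<le> 2 / sqrt (real d)"
    using m d by (simp add: x_def field_simps)
  have "x \<le> real m" using d m by (simp add: x_def field_simps)
  then show "threshold m d \<le> m"
    using t by (metis ceiling_mono ceiling_of_nat of_int_le_iff of_int_of_nat_eq of_nat_le_iff)
qed

text \<open>Independence of the coordinates of a uniformly random function, in counting
  form.\<close>

lemma card_functions_into:
  assumes "S \<subseteq> {..<m}" "0 < m"
  shows "real (card {g \<in> {..<m} \<rightarrow>\<^sub>E {..<m}. \<forall>u\<in>S. g u \<in> A u}) =
    real m ^ m * (\<Prod>u\<in>S. real (card (A u \<inter> {..<m})) / real m)"
proof -
  have eq: "{g \<in> {..<m} \<rightarrow>\<^sub>E {..<m}. \<forall>u\<in>S. g u \<in> A u} =
      PiE {..<m} (\<lambda>u. if u \<in> S then A u \<inter> {..<m} else {..<m})"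
  proof (intro set_eqI iffI)
    fix g assume "g \<in> {g \<in> {..<m} \<rightarrow>\<^sub>E {..<m}. \<forall>u\<in>S. g u \<in> A u}"
    then show "g \<in> PiE {..<m} (\<lambda>u. if u \<in> S then A u \<inter> {..<m} else {..<m})"
      by (auto simp: PiE_iff)
  next
    fix g assume g: "g \<in> PiE {..<m} (\<lambda>u. if u \<in> S then A u \<inter> {..<m} else {..<m})"
    have gu: "g u \<in> (if u \<in> S then A u \<inter> {..<m} else {..<m})" if "u < m" for u
      using PiE_mem[OF g, of u] that by simp
    have "g u \<in> A u" if "u \<in> S" for u
      using gu[of u] that assms(1) by auto
    moreover have "g u < m" if "u < m" for u
      using gu[OF that] by (simp split: if_splits)
    ultimately show "g \<in> {g \<in> {..<m} \<rightarrow>\<^sub>E {..<m}. \<forall>u\<in>S. g u \<in> A u}"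
      using g by (simp add: PiE_iff)
  qed
  have "real (card {g \<in> {..<m} \<rightarrow>\<^sub>E {..<m}. \<forall>u\<in>S. g u \<in> A u}) =
      (\<Prod>u<m. real m * (if u \<in> S then real (card (A u \<inter> {..<m})) / real m else 1))"
    unfolding eq using assms(2) by (subst card_PiE) (auto intro!: prod.cong)
  also have "\<dots> = real m ^ m * (\<Prod>u\<in>{..<m} \<inter> S. real (card (A u \<inter> {..<m})) / real m)"
    by (simp add: prod.distrib prod.inter_restrict)
  also have "{..<m} \<inter> S = S" using assms(1) by blast
  finally show ?thesis .
qed

text \<open>Comparison with the cubic term of the exponential series. It serves to bound
  \<open>s^2 * exp (- s)\<close> by \<open>6 / s\<close> and is the origin of the 6 below.\<close>

lemma cube_le_exp: "x ^ 3 \<le> 6 * exp (x::real)" if "0 \<le> x"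
proof -
  have "summable (\<lambda>i. x ^ i / fact i)"
    using summable_exp[of x] by (simp add: divide_inverse mult.commute)
  then have "(\<Sum>i\<in>{3}. x ^ i / fact i) \<le> (\<Sum>i. x ^ i / fact i)"
    using that by (intro sum_le_suminf) auto
  also have "\<dots> = exp x"
    by (simp add: exp_def divide_inverse mult.commute scaleR_conv_of_real)
  finally show ?thesis by (simp add: fact_numeral)
qed

text \<open>
  Some neighbour \<open>u\<close> of \<open>v\<close> has degree at least \<open>(deg v / a v)\<^sup>2\<close>, where \<open>a v\<close> is the expected
  number of sampled neighbours. The \<open>deg v\<close> edges at an uncovered \<open>v\<close> are charged evenly to the
  neighbours \<open>w\<close> of that \<open>u\<close>; the vertices charging to the same \<open>w\<close> are four steps
  apart from each other, so that each sees all the others in its ball.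
\<close>
lemma uncovered_edges:
  fixes N H :: "nat rel"
  defines "d \<equiv> \<lambda>u. real (card (N `` {u}))"
  assumes G: "graph_pair m N H"
  shows "(\<Sum>v\<in>Domain N. d v * exp (- (\<Sum>u\<in>H `` {v}. 1 / sqrt (d u)))) \<le> 6 * real m"
proof -
  define E where "E = Domain N"
  define s where "s = (\<lambda>v. \<Sum>u\<in>H `` {v}. 1 / sqrt (d u))"
  define a where "a = (\<lambda>v. \<Sum>u\<in>N `` {v}. 1 / sqrt (d u))"
  have N: "N \<subseteq> {..<m} \<times> {..<m}" "sym N" "\<And>i. i \<in> E \<Longrightarrow> (i, i) \<in> N"
    "N O N O N O N \<subseteq> H" "H \<subseteq> E \<times> E"
    using G by (auto simp: graph_pair_def E_def)
  have E: "E \<subseteq> {..<m}" using N(1) by (auto simp: E_def)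
  have finE: "finite E" using E finite_subset by blast
  have NE: "(x, y) \<in> N \<Longrightarrow> x \<in> E \<and> y \<in> E" for x y
    using N(2) by (auto simp: E_def sym_def)
  have finN: "finite (N `` {v})" for v
    by (rule finite_subset[OF _ finE]) (use NE in auto)
  have finH: "finite (H `` {v})" for v
    by (rule finite_subset[OF _ finE]) (use N(5) in auto)
  have d1: "1 \<le> d v" if "v \<in> E" for v
  proof -
    have "N `` {v} \<noteq> {}" using N(3)[OF that] by auto
    then show ?thesis using finN[of v] unfolding d_def by (simp add: Suc_le_eq card_gt_0_iff)
  qed
  have NH: "N `` {v} \<subseteq> H `` {v}" for v
  proof
    fix u assume "u \<in> N `` {v}"
    then have "(v, u) \<in> N" "(u, u) \<in> N" using NE N(3) by auto
    then show "u \<in> H `` {v}" using N(4) by auto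
  qed
  have nn: "0 \<le> 1 / sqrt (d u)" for u by (simp add: d_def)
  have apos: "0 < a v" if "v \<in> E" for v
  proof -
    have "0 < 1 / sqrt (d v)" using d1[OF that] by simp
    also have "\<dots> \<le> a v" unfolding a_def
      using N(3)[OF that] finN nn by (intro member_le_sum) auto
    finally show ?thesis .
  qed
  have a_s: "a v \<le> s v" for v
    unfolding a_def s_def by (intro sum_mono2 finH NH nn)
  \<comment> \<open>Otherwise each of the \<open>d v\<close> summands of \<open>a v\<close> would
    exceed their mean \<open>a v / d v\<close>.\<close>
  have "\<exists>u. (v, u) \<in> N \<and> (d v)\<^sup>2 \<le> (a v)\<^sup>2 * d u" if v: "v \<in> E" for v
  proof (rule ccontr)
    assume "\<not> ?thesis"
    then have lt: "(a v)\<^sup>2 * d u < (d v)\<^sup>2" if "(v, u) \<in> N" for u using that by force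
    have "a v / d v < 1 / sqrt (d u)" if "u \<in> N `` {v}" for u
    proof -
      have u: "u \<in> E" "(v, u) \<in> N" using that NE by auto
      have "sqrt ((a v)\<^sup>2 * d u) < sqrt ((d v)\<^sup>2)" using lt[OF u(2)] by (rule real_sqrt_less_mono)
      then have "a v * sqrt (d u) < d v"
        using apos[OF v] d1[OF v] by (simp add: real_sqrt_mult)
      then show ?thesis using d1[OF v] d1[OF u(1)] by (simp add: field_simps)
    qed
    then have "(\<Sum>u\<in>N `` {v}. a v / d v) < a v" unfolding a_def
      using N(3)[OF v] finN by (intro sum_strict_mono) auto
    moreover have "(\<Sum>u\<in>N `` {v}. a v / d v) = a v"
      using d1[OF v] by (simp add: d_def)
    ultimately show False by simp
  qed
  then obtain h where h: "\<And>v. v \<in> E \<Longrightarrow> (v, h v) \<in> N"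
    "\<And>v. v \<in> E \<Longrightarrow> (d v)\<^sup>2 \<le> (a v)\<^sup>2 * d (h v)" by metis
  \<comment> \<open>The share that \<open>v\<close> charges to each of the \<open>d (h v)\<close>
    neighbours of \<open>h v\<close>; it suffices because
    \<open>(d v)^2 \<le> (s v)^2 * d (h v)\<close>.\<close>
  define c where "c = (\<lambda>v. (s v)\<^sup>2 / d v * exp (- s v))"
  have "d v * exp (- s v) \<le> (\<Sum>w\<in>N `` {h v}. c v)" if v: "v \<in> E" for v
  proof -
    have "(d v)\<^sup>2 \<le> (s v)\<^sup>2 * d (h v)"
      using h(2)[OF v] a_s[of v] apos[OF v]
      by (smt (verit) mult_right_mono power_mono d_def of_nat_0_le_iff)
    then have "d v \<le> (s v)\<^sup>2 / d v * d (h v)"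
      using d1[OF v] by (simp add: field_simps power2_eq_square)
    then have "d v * exp (- s v) \<le> (s v)\<^sup>2 / d v * d (h v) * exp (- s v)"
      by (intro mult_right_mono) auto
    then show ?thesis by (simp add: c_def d_def mult_ac)
  qed
  then have "(\<Sum>v\<in>E. d v * exp (- s v)) \<le> (\<Sum>v\<in>E. \<Sum>w\<in>N `` {h v}. c v)"
    by (rule sum_mono)
  also have "\<dots> = (\<Sum>v\<in>E. \<Sum>w | w \<in> E \<and> (h v, w) \<in> N. c v)"
    using NE by (intro sum.cong) auto
  also have "\<dots> = (\<Sum>w\<in>E. \<Sum>v | v \<in> E \<and> (h v, w) \<in> N. c v)"
    by (rule sum.swap_restrict[OF finE finE])
  also have "\<dots> \<le> (\<Sum>w\<in>E. 6)"
  proof (rule sum_mono)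
    fix w assume "w \<in> E"
    define Z where "Z = {v \<in> E. (h v, w) \<in> N}"
    have finZ: "finite Z" using finE by (simp add: Z_def)
    have ZH: "Z \<subseteq> H `` {v}" if "v \<in> Z" for v
    proof
      fix z assume z: "z \<in> Z"
      have "(v, h v) \<in> N" "(h v, w) \<in> N" "(w, h z) \<in> N" "(h z, z) \<in> N"
        using that z h(1) N(2) by (auto simp: Z_def dest: symD)
      then show "z \<in> H `` {v}" using N(4) by blast
    qed
    define t where "t = (\<Sum>z\<in>Z. 1 / sqrt (d z))"
    \<comment> \<open>As \<open>Z\<close> lies in the ball of \<open>v\<close>,
      \<open>t \<le> s v\<close>. So \<open>c v\<close> is at most \<open>6 / t\<close> times the
      summand of \<open>v\<close> in \<open>t\<close>, and the charges to \<open>w\<close> add up to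
      at most 6.\<close>
    have "c v \<le> 6 / t * (1 / sqrt (d v))" if v: "v \<in> Z" for v
    proof -
      have vE: "v \<in> E" using v by (simp add: Z_def)
      have "0 < 1 / sqrt (d v)" using d1[OF vE] by simp
      also have "1 / sqrt (d v) \<le> t"
        unfolding t_def using finZ v nn by (intro member_le_sum) auto
      finally have t: "0 < t" .
      have ts: "t \<le> s v" unfolding t_def s_def
        using ZH[OF v] finH nn by (intro sum_mono2) auto
      then have s: "0 < s v" using t by linarith
      have "(s v)\<^sup>2 * exp (- s v) \<le> 6 / s v"
        using cube_le_exp[of "s v"] s
        by (simp add: field_simps exp_minus power3_eq_cube power2_eq_square)
      also have "\<dots> \<le> 6 / t" using ts t by (simp add: frac_le)
      finally have 1: "(s v)\<^sup>2 * exp (- s v) \<le> 6 / t" .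
      have 2: "1 / d v \<le> 1 / sqrt (d v)"
        using d1[OF vE] by (simp add: frac_le real_sqrt_le_iff sqrt_le_D real_le_lsqrt power2_eq_square)
      have "c v = (s v)\<^sup>2 * exp (- s v) * (1 / d v)" by (simp add: c_def)
      also have "\<dots> \<le> 6 / t * (1 / sqrt (d v))"
        using 1 2 t by (intro mult_mono) (auto simp: d_def)
      finally show ?thesis .
    qed
    then have "(\<Sum>v\<in>Z. c v) \<le> (\<Sum>v\<in>Z. 6 / t * (1 / sqrt (d v)))" by (rule sum_mono)
    also have "\<dots> = 6 / t * t" unfolding t_def sum_distrib_left by simp
    also have "\<dots> \<le> 6" by simp
    finally show "(\<Sum>v | v \<in> E \<and> (h v, w) \<in> N. c v) \<le> 6" by (simp add: Z_def)
  qed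
  also have "\<dots> \<le> 6 * real m" using card_mono[OF _ E] by simp
  finally show ?thesis by (simp add: E_def s_def)
qed

lemma load_le_card: "finite A \<Longrightarrow> load A B X i \<le> card A"
  by (simp add: load_def card_mono)

text \<open>\<open>11 = 1 + 2 + 2 + 6\<close>: loops, edges inside the sample attributed to either
  endpoint, and edges at uncovered vertices.\<close>

lemma sum_total_load:
  assumes G: "graph_pair m N H" and m: "0 < m"
  shows "(\<Sum>g\<in>{..<m} \<rightarrow>\<^sub>E {..<m}. real (total_load m N H g)) \<le> 11 * real m * real m ^ m"
proof -
  define E where "E = Domain N"
  define \<Omega> where "\<Omega> = ({..<m} \<rightarrow>\<^sub>E {..<m} :: (nat \<Rightarrow> nat) set)"
  define d where "d = (\<lambda>u. card (N `` {u}))"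
  define q where "q = (\<lambda>u. real (threshold m (d u)) / real m)"
  define X where "X = sample m E d"
  have N: "N \<subseteq> {..<m} \<times> {..<m}" "sym N" "\<And>i. i \<in> E \<Longrightarrow> (i, i) \<in> N" "H \<subseteq> E \<times> E"
    using G by (auto simp: graph_pair_def E_def)
  have E: "E \<subseteq> {..<m}" using N(1) by (auto simp: E_def)
  have finE: "finite E" using E finite_subset by blast
  have NE: "(x, y) \<in> N \<Longrightarrow> x \<in> E \<and> y \<in> E" for x y
    using N(2) by (auto simp: E_def sym_def)
  have finN: "finite (N `` {v})" for v
    by (rule finite_subset[OF _ finE]) (use NE in auto)
  have fin\<Omega>: "finite \<Omega>" by (simp add: \<Omega>_def finite_PiE)
  have d1: "1 \<le> d v" "d v \<le> m" if "v \<in> E" for v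
  proof -
    have "N `` {v} \<noteq> {}" using N(3)[OF that] by auto
    then show "1 \<le> d v" using finN[of v] unfolding d_def by (simp add: Suc_le_eq card_gt_0_iff)
    have "N `` {v} \<subseteq> {..<m}" using NE E by auto
    then show "d v \<le> m" unfolding d_def using card_mono[of "{..<m}"] by fastforce
  qed
  have q: "1 / sqrt (real (d v)) \<le> q v" "q v \<le> 2 / sqrt (real (d v))" "threshold m (d v) \<le> m"
    "q v \<le> 1" if "v \<in> E" for v
    using threshold_bounds[OF d1[OF that]] m by (auto simp: q_def)
  have q0: "0 \<le> q v" for v by (simp add: q_def)
  have hit: "real (card {g \<in> \<Omega>. \<forall>u\<in>S. u \<in> X g}) = real m ^ m * (\<Prod>u\<in>S. q u)" if "S \<subseteq> E" for S
  proof -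
    have "{g \<in> \<Omega>. \<forall>u\<in>S. u \<in> X g} = {g \<in> \<Omega>. \<forall>u\<in>S. g u \<in> {..<threshold m (d u)}}"
      using that by (auto simp: X_def sample_def)
    moreover have "{..<threshold m (d u)} \<inter> {..<m} = {..<threshold m (d u)}" if "u \<in> E" for u
      using q(3)[OF that] by auto
    ultimately show ?thesis
      using card_functions_into[of S m "\<lambda>u. {..<threshold m (d u)}"] that E m
      by (simp add: \<Omega>_def q_def subset_iff)
  qed
  have miss: "real (card {g \<in> \<Omega>. S \<inter> X g = {}}) \<le> real m ^ m * exp (- (\<Sum>u\<in>S. 1 / sqrt (d u)))"
    if "S \<subseteq> E" for S
  proof -
    have finS: "finite S" using that finE finite_subset by blast
    have "{g \<in> \<Omega>. S \<inter> X g = {}} = {g \<in> \<Omega>. \<forall>u\<in>S. g u \<in> {threshold m (d u)..}}"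
      using that by (auto simp: X_def sample_def)
    moreover have "{threshold m (d u)..} \<inter> {..<m} = {threshold m (d u)..<m}" for u
      by auto
    ultimately have "real (card {g \<in> \<Omega>. S \<inter> X g = {}}) =
        real m ^ m * (\<Prod>u\<in>S. real (m - threshold m (d u)) / real m)"
      using card_functions_into[of S m "\<lambda>u. {threshold m (d u)..}"] that E m
      by (simp add: \<Omega>_def subset_iff)
    also have "\<dots> \<le> real m ^ m * (\<Prod>u\<in>S. exp (- (1 / sqrt (d u))))"
    proof (intro mult_left_mono prod_mono conjI)
      fix u assume "u \<in> S"
      then have u: "u \<in> E" using that by blast
      have "real (m - threshold m (d u)) / real m = 1 - q u"
        using q(3)[OF u] m by (simp add: q_def of_nat_diff diff_divide_distrib)
      also have "\<dots> \<le> 1 + - (1 / sqrt (d u))" using q(1)[OF u] by simp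
      also have "\<dots> \<le> exp (- (1 / sqrt (d u)))" by (rule exp_ge_add_one_self)
      finally show "real (m - threshold m (d u)) / real m \<le> exp (- (1 / sqrt (d u)))" .
    qed auto
    also have "(\<Prod>u\<in>S. exp (- (1 / sqrt (d u)))) = exp (- (\<Sum>u\<in>S. 1 / sqrt (d u)))"
      using finS by (simp add: exp_sum sum_negf[symmetric])
    finally show ?thesis .
  qed
  have HE: "H `` {i} \<subseteq> E" for i using N(4) by auto
  have load: "real (load (N `` {i}) (H `` {i}) (X g) i) \<le>
      (\<Sum>u\<in>N `` {i}. of_bool (i \<in> X g \<and> u \<in> X g)) + real (d i) * of_bool (H `` {i} \<inter> X g = {})" for i g
  proof -
    have "(\<Sum>u\<in>N `` {i}. of_bool (i \<in> X g \<and> u \<in> X g) :: real) = of_bool (i \<in> X g) * real (card (N `` {i} \<inter> X g))"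
      using finN[of i] by (simp add: of_bool_conj sum_distrib_left[symmetric] Int_def)
    then show ?thesis by (simp add: load_def d_def)
  qed
  have "(\<Sum>g\<in>\<Omega>. real (total_load m N H g)) =
      (\<Sum>g\<in>\<Omega>. \<Sum>i\<in>E. real (load (N `` {i}) (H `` {i}) (X g) i))"
    by (simp add: total_load_def E_def X_def d_def)
  also have "\<dots> \<le> (\<Sum>g\<in>\<Omega>. \<Sum>i\<in>E. (\<Sum>u\<in>N `` {i}. of_bool (i \<in> X g \<and> u \<in> X g)) +
      real (d i) * of_bool (H `` {i} \<inter> X g = {}))"
    by (intro sum_mono load)
  also have "\<dots> = (\<Sum>i\<in>E. (\<Sum>u\<in>N `` {i}. \<Sum>g\<in>\<Omega>. of_bool (i \<in> X g \<and> u \<in> X g)) +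
      real (d i) * (\<Sum>g\<in>\<Omega>. of_bool (H `` {i} \<inter> X g = {})))"
    by (subst sum.swap, intro sum.cong refl)
      (simp add: sum.distrib sum_distrib_left, rule sum.swap)
  also have "\<dots> = (\<Sum>i\<in>E. (\<Sum>u\<in>N `` {i}. real (card {g \<in> \<Omega>. \<forall>w\<in>{i, u}. w \<in> X g})) +
      real (d i) * real (card {g \<in> \<Omega>. H `` {i} \<inter> X g = {}}))"
    using fin\<Omega> by (simp add: Int_def)
  also have "\<dots> \<le> (\<Sum>i\<in>E. (\<Sum>u\<in>N `` {i}. real m ^ m * (of_bool (u = i) + 2 * (1 / d i + 1 / d u))) +
      real (d i) * (real m ^ m * exp (- (\<Sum>u\<in>H `` {i}. 1 / sqrt (d u)))))"
  proof (intro sum_mono add_mono mult_left_mono)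
    fix i u assume i: "i \<in> E" and "u \<in> N `` {i}"
    then have u: "u \<in> E" using NE by auto
    have "(\<Prod>w\<in>{i, u}. q w) \<le> of_bool (u = i) + 2 * (1 / d i + 1 / d u)"
    proof (cases "u = i")
      case True
      then show ?thesis using q(4)[OF i] by (simp add: add_increasing2)
    next
      case False
      have "q i * q u \<le> (2 / sqrt (d i)) * (2 / sqrt (d u))"
        using q(2)[OF i] q(2)[OF u] q0 by (intro mult_mono) auto
      also have "\<dots> = 2 * (2 * (1 / sqrt (d i)) * (1 / sqrt (d u)))" by simp
      \<comment> \<open>The inequality of arithmetic and geometric means separates the two degrees,
        so that summing \<open>1 / d i\<close> over the neighbours of \<open>i\<close> leaves a
        constant per vertex.\<close>
      also have "\<dots> \<le> 2 * ((1 / sqrt (d i))\<^sup>2 + (1 / sqrt (d u))\<^sup>2)"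
        by (intro mult_left_mono sum_squares_bound) simp
      also have "\<dots> = 2 * (1 / d i + 1 / d u)" by (simp add: power_divide)
      finally show ?thesis using False by simp
    qed
    then have "real m ^ m * (\<Prod>w\<in>{i, u}. q w) \<le> real m ^ m * (of_bool (u = i) + 2 * (1 / d i + 1 / d u))"
      by (rule mult_left_mono) simp
    then show "real (card {g \<in> \<Omega>. \<forall>w\<in>{i, u}. w \<in> X g}) \<le> real m ^ m * (of_bool (u = i) + 2 * (1 / d i + 1 / d u))"
      using hit[of "{i, u}"] i u by simp
  qed (use miss HE in auto)
  also have "\<dots> = real m ^ m * ((\<Sum>i\<in>E. \<Sum>u\<in>N `` {i}. of_bool (u = i)) +
      2 * (\<Sum>i\<in>E. \<Sum>u\<in>N `` {i}. 1 / real (d i)) + 2 * (\<Sum>i\<in>E. \<Sum>u\<in>N `` {i}. 1 / real (d u)) +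
      (\<Sum>i\<in>E. real (d i) * exp (- (\<Sum>u\<in>H `` {i}. 1 / sqrt (d u)))))"
    by (simp add: sum.distrib sum_distrib_left algebra_simps)
  also have "\<dots> \<le> real m ^ m * (real m + 2 * real m + 2 * real m + 6 * real m)"
  proof (intro mult_left_mono add_mono)
    have cE: "real (card E) \<le> real m" using card_mono[OF _ E] by simp
    have "(\<Sum>u\<in>N `` {i}. of_bool (u = i)) = (1 :: real)" if "i \<in> E" for i
      using finN[of i] N(3)[OF that] by (simp add: of_bool_def)
    then show "(\<Sum>i\<in>E. \<Sum>u\<in>N `` {i}. of_bool (u = i)) \<le> real m" using cE by simp
    have "(\<Sum>u\<in>N `` {i}. 1 / real (d i)) = 1" if "i \<in> E" for i
      using d1[OF that] by (simp add: d_def)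
    then have one: "(\<Sum>i\<in>E. \<Sum>u\<in>N `` {i}. 1 / real (d i)) = real (card E)"
      by (simp only: sum_constant mult_1_right cong: sum.cong)
    then show "(\<Sum>i\<in>E. \<Sum>u\<in>N `` {i}. 1 / real (d i)) \<le> real m" using cE by simp
    have "(\<Sum>i\<in>E. \<Sum>u\<in>N `` {i}. 1 / real (d u)) = (\<Sum>i\<in>E. \<Sum>u | u \<in> E \<and> (i, u) \<in> N. 1 / real (d u))"
      using NE by (intro sum.cong) auto
    also have "\<dots> = (\<Sum>u\<in>E. \<Sum>i | i \<in> E \<and> (i, u) \<in> N. 1 / real (d u))"
      by (rule sum.swap_restrict[OF finE finE])
    also have "\<dots> = (\<Sum>u\<in>E. \<Sum>i\<in>N `` {u}. 1 / real (d u))"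
      using NE N(2) by (intro sum.cong) (auto dest: symD)
    finally show "(\<Sum>i\<in>E. \<Sum>u\<in>N `` {i}. 1 / real (d u)) \<le> real m" using one cE by simp
    show "(\<Sum>i\<in>E. real (d i) * exp (- (\<Sum>u\<in>H `` {i}. 1 / sqrt (d u)))) \<le> 6 * real m"
      using uncovered_edges[OF G] by (simp add: E_def d_def)
  qed auto
  finally show ?thesis by (simp add: \<Omega>_def mult.commute)
qed

lemma total_load_le:
  assumes "graph_pair m N H"
  shows "total_load m N H g \<le> m\<^sup>2"
proof -
  have N: "N \<subseteq> {..<m} \<times> {..<m}" using assms by (simp add: graph_pair_def)
  have card: "card A \<le> m" if "A \<subseteq> {..<m}" for A
    using card_mono[OF _ that] by simp
  have "total_load m N H g \<le> (\<Sum>i\<in>Domain N. m)"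
    unfolding total_load_def
  proof (rule sum_mono)
    fix i
    have "N `` {i} \<subseteq> {..<m}" using N by auto
    then show "load (N `` {i}) (H `` {i}) (sample m (Domain N) (\<lambda>u. card (N `` {u})) g) i \<le> m"
      using load_le_card card finite_subset by (meson finite_lessThan order_trans)
  qed
  also have "\<dots> \<le> m * m" using card[of "Domain N"] N by (auto intro: mult_right_mono)
  finally show ?thesis by (simp add: power2_eq_square)
qed

text \<open>
  Exponential moments: the average of \<open>exp (load / m\<^sup>2)\<close> over independent random functions is
  multiplicative, so a family of \<open>m\<^sup>3\<close> of them beats the number of graphs in a union bound.
\<close>
lemma good_family:
  assumes K: "finite K" and m: "0 < m" and cK: "m ^ 3 \<le> 8 * card K"
  shows "\<exists>Fam. \<forall>N H. graph_pair m N H \<longrightarrow>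
    (\<Sum>k\<in>K. real (total_load m N H (Fam k))) \<le> 38 * real m * real (card K)"
proof -
  define \<Omega> where "\<Omega> = ({..<m} \<rightarrow>\<^sub>E {..<m} :: (nat \<Rightarrow> nat) set)"
  define \<G> where "\<G> = {p. graph_pair m (fst p) (snd p)}"
  define M where "M = real (m\<^sup>2)"
  define \<Phi> where "\<Phi> = (\<lambda>p Fam. exp ((\<Sum>k\<in>K. real (total_load m (fst p) (snd p) (Fam k))) / M))"
  have M0: "0 < M" using m by (simp add: M_def)
  have fin\<Omega>: "finite \<Omega>" by (simp add: \<Omega>_def finite_PiE)
  have card\<Omega>: "card \<Omega> = m ^ m" by (simp add: \<Omega>_def card_PiE)
  have \<G>sub: "\<G> \<subseteq> Pow ({..<m} \<times> {..<m}) \<times> Pow ({..<m} \<times> {..<m})"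
  proof
    fix p assume "p \<in> \<G>"
    then have "fst p \<subseteq> {..<m} \<times> {..<m}" "snd p \<subseteq> Domain (fst p) \<times> Domain (fst p)"
      by (auto simp: \<G>_def graph_pair_def)
    moreover from this have "Domain (fst p) \<subseteq> {..<m}" by auto
    ultimately show "p \<in> Pow ({..<m} \<times> {..<m}) \<times> Pow ({..<m} \<times> {..<m})"
      by (cases p) (auto simp del: Domain_iff)
  qed
  then have fin\<G>: "finite \<G>" by (rule finite_subset) simp
  have "card \<G> \<le> card (Pow ({..<m} \<times> {..<m}) \<times> Pow ({..<m} \<times> {..<m}))"
    using \<G>sub by (intro card_mono) auto
  also have "\<dots> = 2 ^ (2 * m\<^sup>2)"
    by (simp add: card_cartesian_product card_Pow power_add[symmetric] power2_eq_square mult_2)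
  finally have card\<G>: "real (card \<G>) \<le> 2 ^ (2 * m\<^sup>2)"
    by (metis of_nat_le_iff of_nat_numeral of_nat_power)
  have one: "(\<Sum>g\<in>\<Omega>. exp (real (total_load m N H g) / M)) \<le> real m ^ m * exp (22 / real m)"
    if G: "graph_pair m N H" for N H
  proof -
    \<comment> \<open>The scaling by \<open>M\<close> puts the exponents into \<open>[0, 1]\<close>,
      where \<open>exp x \<le> 1 + 2 * x\<close>; the moment is thus controlled by the mean, and 22
      is twice 11.\<close>
    have "(\<Sum>g\<in>\<Omega>. exp (real (total_load m N H g) / M)) \<le> (\<Sum>g\<in>\<Omega>. 1 + 2 * (real (total_load m N H g) / M))"
    proof (rule sum_mono)
      fix g
      have "real (total_load m N H g) \<le> M"
        using total_load_le[OF G, of g] unfolding M_def of_nat_le_iff .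
      then have "0 \<le> real (total_load m N H g) / M" "real (total_load m N H g) / M \<le> 1"
        using M0 by auto
      then have "exp (real (total_load m N H g) / M) \<le>
          1 + real (total_load m N H g) / M + (real (total_load m N H g) / M)\<^sup>2"
        by (rule exp_bound)
      also have "(real (total_load m N H g) / M)\<^sup>2 \<le> real (total_load m N H g) / M"
        unfolding power2_eq_square
        by (rule mult_left_le) fact+
      finally show "exp (real (total_load m N H g) / M) \<le> 1 + 2 * (real (total_load m N H g) / M)"
        by simp
    qed
    also have "\<dots> = real m ^ m + 2 / M * (\<Sum>g\<in>\<Omega>. real (total_load m N H g))"
      by (simp add: sum.distrib card\<Omega> sum_distrib_left)
    also have "\<dots> \<le> real m ^ m + 2 / M * (11 * real m * real m ^ m)"
      using sum_total_load[OF G m] M0 unfolding \<Omega>_def by (intro add_left_mono mult_left_mono) auto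
    also have "\<dots> = real m ^ m * (1 + 22 / real m)"
      using m by (simp add: M_def power2_eq_square field_simps)
    also have "\<dots> \<le> real m ^ m * exp (22 / real m)"
      by (intro mult_left_mono exp_ge_add_one_self) auto
    finally show ?thesis .
  qed
  have many: "(\<Sum>Fam\<in>K \<rightarrow>\<^sub>E \<Omega>. \<Phi> p Fam) \<le> (real m ^ m * exp (22 / real m)) ^ card K"
    if p: "p \<in> \<G>" for p
  proof -
    have "(\<Sum>Fam\<in>K \<rightarrow>\<^sub>E \<Omega>. \<Phi> p Fam) =
        (\<Sum>Fam\<in>K \<rightarrow>\<^sub>E \<Omega>. \<Prod>k\<in>K. exp (real (total_load m (fst p) (snd p) (Fam k)) / M))"
      using K by (simp add: \<Phi>_def exp_sum sum_divide_distrib)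
    also have "\<dots> = (\<Prod>k\<in>K. \<Sum>g\<in>\<Omega>. exp (real (total_load m (fst p) (snd p) g) / M))"
      by (rule prod_sum_PiE[symmetric]) (use K fin\<Omega> in auto)
    also have "\<dots> = (\<Sum>g\<in>\<Omega>. exp (real (total_load m (fst p) (snd p) g) / M)) ^ card K"
      by simp
    also have "\<dots> \<le> (real m ^ m * exp (22 / real m)) ^ card K"
      using p by (intro power_mono one sum_nonneg) (auto simp: \<G>_def)
    finally show ?thesis .
  qed
  define b where "b = real (card \<G>) * exp (22 / real m) ^ card K"
  have ne: "K \<rightarrow>\<^sub>E \<Omega> \<noteq> {}"
    using m by (simp add: \<Omega>_def PiE_eq_empty_iff) (metis lessThan_iff empty_iff)
  have cardF: "card (K \<rightarrow>\<^sub>E \<Omega>) = (m ^ m) ^ card K"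
    using K by (simp add: card_PiE card\<Omega>)
  \<comment> \<open>The bound \<open>b\<close> on the average is attained by some family for the sum
    over all graph pairs; the summands being positive, it then holds for each pair.\<close>
  have "\<exists>Fam\<in>K \<rightarrow>\<^sub>E \<Omega>. (\<Sum>p\<in>\<G>. \<Phi> p Fam) \<le> b"
  proof (rule ccontr)
    assume "\<not> ?thesis"
    then have "(\<Sum>Fam\<in>K \<rightarrow>\<^sub>E \<Omega>. b) < (\<Sum>Fam\<in>K \<rightarrow>\<^sub>E \<Omega>. \<Sum>p\<in>\<G>. \<Phi> p Fam)"
      using ne K fin\<Omega> by (intro sum_strict_mono) (auto simp: finite_PiE not_le)
    also have "\<dots> = (\<Sum>p\<in>\<G>. \<Sum>Fam\<in>K \<rightarrow>\<^sub>E \<Omega>. \<Phi> p Fam)" by (rule sum.swap)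
    also have "\<dots> \<le> (\<Sum>p\<in>\<G>. (real m ^ m * exp (22 / real m)) ^ card K)"
      by (intro sum_mono many)
    also have "\<dots> = (\<Sum>Fam\<in>K \<rightarrow>\<^sub>E \<Omega>. b)"
      by (simp add: cardF b_def power_mult_distrib)
    finally show False by simp
  qed
  then obtain Fam where Fam: "Fam \<in> K \<rightarrow>\<^sub>E \<Omega>" "(\<Sum>p\<in>\<G>. \<Phi> p Fam) \<le> b" by blast
  have "(\<Sum>k\<in>K. real (total_load m N H (Fam k))) \<le> 38 * real m * real (card K)"
    if G: "graph_pair m N H" for N H
  proof -
    have "\<Phi> (N, H) Fam \<le> (\<Sum>p\<in>\<G>. \<Phi> p Fam)"
      using fin\<G> G by (intro member_le_sum) (auto simp: \<G>_def \<Phi>_def)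
    also have "\<dots> \<le> b" by (rule Fam)
    also have "\<dots> \<le> 2 ^ (2 * m\<^sup>2) * exp (22 / real m) ^ card K"
      unfolding b_def by (intro mult_right_mono card\<G>) auto
    also have "(2::real) ^ (2 * m\<^sup>2) \<le> exp 1 ^ (2 * m\<^sup>2)"
      using exp_ge_add_one_self[of 1] by (intro power_mono) auto
    also have "exp 1 ^ (2 * m\<^sup>2) * exp (22 / real m) ^ card K =
        exp (real (2 * m\<^sup>2) + real (card K) * (22 / real m))"
      unfolding exp_add exp_of_nat_mult using exp_of_nat_mult[of "2 * m\<^sup>2" "1::real"]
      by (simp only: mult_1_right)
    finally have "(\<Sum>k\<in>K. real (total_load m N H (Fam k))) / M \<le>
        real (2 * m\<^sup>2) + real (card K) * (22 / real m)"
      by (simp add: \<Phi>_def)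
    then have "(\<Sum>k\<in>K. real (total_load m N H (Fam k))) \<le>
        (real (2 * m\<^sup>2) + real (card K) * (22 / real m)) * M"
      using M0 by (simp add: pos_divide_le_eq)
    \<comment> \<open>The number of graphs costs \<open>2 * m ^ 4\<close> and the mean costs
      \<open>22 * m * card K\<close>. The hypothesis turns the former into
      \<open>16 * m * card K\<close>, and \<open>16 + 22 = 38\<close>.\<close>
    also have "\<dots> = 2 * real m * real (m ^ 3) + 22 * real m * real (card K)"
      using m by (simp add: M_def power2_eq_square power3_eq_cube field_simps)
    also have "\<dots> \<le> 2 * real m * real (8 * card K) + 22 * real m * real (card K)"
      using cK by (intro add_right_mono mult_left_mono of_nat_mono) auto
    finally show ?thesis by simp
  qed
  then show ?thesis by blast
qed

section \<open>Knowledge in the Congested Clique\<close>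

text \<open>The message histories of a deterministic sending rule, free of coins and halting; those
  of a coinless algorithm coincide with them as long as nobody has decided.\<close>

primrec hist :: "(view \<Rightarrow> history \<Rightarrow> node \<Rightarrow> message) \<Rightarrow> flp \<Rightarrow> nat \<Rightarrow> node \<Rightarrow> history" where
  "hist S I 0 = (\<lambda>v. [])"
| "hist S I (Suc t) = (\<lambda>v. hist S I t v @
     [\<lambda>u. if u \<in> nodes I \<and> u \<noteq> v then S (initial_view I u) (hist S I t u) v else []])"

text \<open>Protocols are never written as programs; what each node knows after a number of rounds
  is tracked instead. The length bound is imposed on all arguments, even on histories that never
  occur, so that it passes to the final algorithm without an invariant.\<close>

definition computable :: "flp set \<Rightarrow> nat \<Rightarrow> nat \<Rightarrow> (flp \<Rightarrow> node \<Rightarrow> 'a) \<Rightarrow> bool" where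
  "computable \<I> B R K \<longleftrightarrow> (\<exists>S D. (\<forall>V h v. length (S V h v) \<le> B) \<and>
     (\<forall>I\<in>\<I>. \<forall>v\<in>nodes I. K I v = D (initial_view I v) (hist S I R v)))"

text \<open>The view is carried along so that later messages may depend on private input and shared
  information together.\<close>

definition common :: "flp set \<Rightarrow> nat \<Rightarrow> nat \<Rightarrow> (flp \<Rightarrow> 'a) \<Rightarrow> bool" where
  "common \<I> B R G \<longleftrightarrow> computable \<I> B R (\<lambda>I v. (initial_view I v, G I))"

lemma length_hist [simp]: "length (hist S I t v) = t"
  by (induction t) auto

text \<open>Lets a protocol be extended by a further round without disturbing the earlier
  ones.\<close>

lemma hist_cong:
  assumes "\<And>u t v. t < R \<Longrightarrow> S (initial_view I u) (hist S' I t u) v = S' (initial_view I u) (hist S' I t u) v"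
    and "r \<le> R"
  shows "hist S I r v = hist S' I r v"
  using assms(2)
proof (induction r arbitrary: v)
  case (Suc r)
  then have IH: "hist S I r u = hist S' I r u" for u by simp
  show ?case using assms(1)[of r] Suc.prems by (auto simp: IH)
qed simp

lemma self_initial_view [simp]: "self (initial_view I v) = v"
  and all_facilities_initial_view [simp]: "all_facilities (initial_view I v) = facilities I"
  and all_clients_initial_view [simp]: "all_clients (initial_view I v) = clients I"
  by (simp_all add: initial_view_def)

lemma Inl_in_nodes [simp]: "Inl i \<in> nodes I \<longleftrightarrow> i \<in> facilities I"
  and Inr_in_nodes [simp]: "Inr j \<in> nodes I \<longleftrightarrow> j \<in> clients I"
  by (auto simp: nodes_def)

lemma computable_mono:
  assumes "computable \<I> B R K" "\<And>I v. I \<in> \<I> \<Longrightarrow> v \<in> nodes I \<Longrightarrow> K' I v = \<phi> (K I v)"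
  shows "computable \<I> B R K'"
proof -
  from assms(1) obtain S D where SD: "\<forall>V h v. length (S V h v) \<le> B"
    "\<forall>I\<in>\<I>. \<forall>v\<in>nodes I. K I v = D (initial_view I v) (hist S I R v)"
    unfolding computable_def by blast
  show ?thesis unfolding computable_def
    by (rule exI[of _ S], rule exI[of _ "\<lambda>V h. \<phi> (D V h)"]) (use SD assms(2) in simp)
qed

lemma ex_encoding:
  assumes "finite Q" "card Q \<le> 2 ^ B"
  shows "\<exists>enc :: 'x \<Rightarrow> message. inj_on enc Q \<and> (\<forall>x. length (enc x) \<le> B)"
proof -
  have fin: "finite {w :: bool list. length w = B}"
    using finite_lists_length_eq[of "UNIV :: bool set" B] by simp
  have "card {w :: bool list. length w = B} = 2 ^ B"
    using card_lists_length_eq[of "UNIV :: bool set" B] by simp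
  then obtain e where e: "inj_on e Q" "e ` Q \<subseteq> {w :: bool list. length w = B}"
    using card_le_inj[OF assms(1) fin] assms(2) by auto
  \<comment> \<open>The default \<open>[]\<close> outside \<open>Q\<close> makes the length bound
    unconditional, as \<open>computable\<close> demands.\<close>
  have "inj_on (\<lambda>x. if x \<in> Q then e x else []) Q"
    using e(1) by (simp add: inj_on_def)
  moreover have "\<forall>x. length (if x \<in> Q then e x else []) \<le> B"
    using e(2) by auto
  ultimately show ?thesis by blast
qed

lemma computable_step:
  assumes K: "computable \<I> B R K"
    and Q: "finite Q" "card Q \<le> 2 ^ B"
    and M: "\<And>I u v. I \<in> \<I> \<Longrightarrow> u \<in> nodes I \<Longrightarrow> v \<in> nodes I \<Longrightarrow> M (K I u) v \<in> Q"
  shows "computable \<I> B (Suc R) (\<lambda>I v. (K I v, restrict (\<lambda>u. M (K I u) v) (nodes I)))"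
proof -
  from K obtain S D where S: "\<And>V h v. length (S V h v) \<le> B"
    and D: "\<And>I v. I \<in> \<I> \<Longrightarrow> v \<in> nodes I \<Longrightarrow> K I v = D (initial_view I v) (hist S I R v)"
    unfolding computable_def by blast
  from ex_encoding[OF Q] obtain enc :: "_ \<Rightarrow> message"
    where enc: "inj_on enc Q" "\<And>x. length (enc x) \<le> B" by blast
  \<comment> \<open>The length of the history serves as the round counter.\<close>
  define S' where "S' = (\<lambda>V h v. if length h < R then S V h v else enc (M (D V h) v))"
  have S'_eq: "S' V h v = (if length h < R then S V h v else enc (M (D V h) v))" for V h v
    by (simp add: S'_def)
  \<comment> \<open>A node receives nothing from itself, so its own entry is recomputed instead of
    decoded.\<close>
  define D' where "D' = (\<lambda>V h. (D V (take R h),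
    restrict (\<lambda>u. if u = self V then M (D V (take R h)) u else inv_into Q enc ((h ! R) u))
      (all_facilities V <+> all_clients V)))"
  have old: "hist S' I R u = hist S I R u" for I u
    by (rule hist_cong[where R = R]) (auto simp: S'_def)
  have "(K I v, restrict (\<lambda>u. M (K I u) v) (nodes I)) = D' (initial_view I v) (hist S' I (Suc R) v)"
    if I: "I \<in> \<I>" and v: "v \<in> nodes I" for I v
  proof -
    have "inv_into Q enc (enc (M (K I u) v)) = M (K I u) v" if "u \<in> nodes I" for u
      using M[OF I that v] enc(1) by simp
    moreover have "S' (initial_view I u) (hist S' I R u) v = enc (M (K I u) v)" if "u \<in> nodes I" for u
      using D[OF I that] by (simp add: S'_eq old)
    ultimately show ?thesis
      using D[OF I] v
      by (auto simp: D'_def old nth_append nodes_def[symmetric] fun_eq_iff)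
  qed
  moreover have "length (S' V h v) \<le> B" for V h v
    using S enc(2) by (simp add: S'_def)
  ultimately show ?thesis unfolding computable_def by blast
qed

section \<open>Information shared by all nodes\<close>

lemma common_mono:
  assumes "common \<I> B R G" "\<And>I. I \<in> \<I> \<Longrightarrow> G' I = \<phi> (G I)"
  shows "common \<I> B R G'"
  unfolding common_def
  by (rule computable_mono[OF assms(1)[unfolded common_def], of _ "\<lambda>(V, g). (V, \<phi> g)"])
    (use assms(2) in simp)

lemma common_init: "common \<I> B 0 (\<lambda>I. (facilities I, clients I))"
  unfolding common_def computable_def
  by (rule exI[of _ "\<lambda>_ _ _. []"], rule exI[of _ "\<lambda>V h. (V, all_facilities V, all_clients V)"]) simp

lemma common_broadcast:
  assumes G: "common \<I> B R G"
    and Q: "finite Q" "card Q \<le> 2 ^ B"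
    and x: "\<And>I u. I \<in> \<I> \<Longrightarrow> u \<in> nodes I \<Longrightarrow> x (initial_view I u) (G I) \<in> Q"
  shows "common \<I> B (Suc R) (\<lambda>I. (G I, restrict (\<lambda>u. x (initial_view I u) (G I)) (nodes I)))"
proof -
  have "computable \<I> B (Suc R) (\<lambda>I v. ((initial_view I v, G I),
      restrict (\<lambda>u. (\<lambda>(V, g) _. x V g) (initial_view I u, G I) v) (nodes I)))"
    by (rule computable_step[OF G[unfolded common_def] Q]) (simp add: x)
  then show ?thesis unfolding common_def
    by (rule computable_mono[where \<phi> = "\<lambda>((V, g), y). (V, g, y)"]) simp
qed

text \<open>Node \<open>w\<close> condenses what is addressed to it and announces the result, so
  that as many aggregates as there are nodes become common in two rounds.\<close>

lemma common_relay:
  assumes G: "common \<I> B R G"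
    and Q: "finite Q" "card Q \<le> 2 ^ B"
    and x: "\<And>I u w. I \<in> \<I> \<Longrightarrow> u \<in> nodes I \<Longrightarrow> w \<in> nodes I \<Longrightarrow> x (initial_view I u) (G I) w \<in> Q"
    and Q': "finite Q'" "card Q' \<le> 2 ^ B"
    and y: "\<And>I w. I \<in> \<I> \<Longrightarrow> w \<in> nodes I \<Longrightarrow>
      y (G I) (restrict (\<lambda>u. x (initial_view I u) (G I) w) (nodes I)) \<in> Q'"
  shows "common \<I> B (R + 2) (\<lambda>I. (G I,
    restrict (\<lambda>w. y (G I) (restrict (\<lambda>u. x (initial_view I u) (G I) w) (nodes I))) (nodes I)))"
proof -
  define K where "K = (\<lambda>I v. ((initial_view I v, G I), restrict (\<lambda>u. x (initial_view I u) (G I) v) (nodes I)))"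
  have "computable \<I> B (Suc R) (\<lambda>I v. ((initial_view I v, G I),
      restrict (\<lambda>u. (\<lambda>(V, g). x V g) (initial_view I u, G I) v) (nodes I)))"
    by (rule computable_step[OF G[unfolded common_def] Q]) (simp add: x)
  then have "computable \<I> B (Suc R) K" by (simp add: K_def)
  then have "computable \<I> B (Suc (Suc R)) (\<lambda>I v. (K I v,
      restrict (\<lambda>u. (\<lambda>((V, g), z) _. y g z) (K I u) v) (nodes I)))"
    by (rule computable_step[OF _ Q']) (simp add: K_def y)
  then show ?thesis unfolding common_def K_def
    by (simp add: numeral_2_eq_2, rule computable_mono[where \<phi> = "\<lambda>(((V, g), z), y). (V, g, y)"]) simp
qed

section \<open>From a protocol to an algorithm\<close>

lemma prob_space_tapes: "prob_space (tapes I)"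
  unfolding tapes_def
  by (intro prob_space_PiM prob_space.prob_space_stream_space) (rule measure_pmf.prob_space_axioms)

lemma algorithm_of_knowledge:
  fixes \<I> :: "nat \<Rightarrow> flp set" and B :: "nat \<Rightarrow> nat"
  assumes K: "\<And>n. n \<ge> 1 \<Longrightarrow> computable (\<I> n) (B n) R (K n)"
    and card: "\<And>n I. I \<in> \<I> n \<Longrightarrow> card (facilities I) = n"
  shows "\<exists>A. \<forall>n\<ge>1. \<forall>I\<in>\<I> n. bandwidth_at_most A I (B n) \<and>
    (\<forall>\<omega>. halted A I \<omega> R \<and> solution A I \<omega> R =
      ({j \<in> clients I. K n I (Inr j)}, {i \<in> facilities I. K n I (Inl i)}))"
proof -
  from K obtain S D where S: "\<And>n V h v. n \<ge> 1 \<Longrightarrow> length (S n V h v) \<le> B n"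
    and D: "\<And>n I v. n \<ge> 1 \<Longrightarrow> I \<in> \<I> n \<Longrightarrow> v \<in> nodes I \<Longrightarrow>
      K n I v = D n (initial_view I v) (hist (S n) I R v)"
    unfolding computable_def by metis
  \<comment> \<open>No coin is tossed. The rules depend on \<open>n\<close>, which every node reads
    off its view as the number of facilities; thus one algorithm serves all
    \<open>n\<close>.\<close>
  define A where "A = \<lparr> tosses = (\<lambda>V t. 0),
    send = (\<lambda>V c h v. S (card (all_facilities V)) V h v),
    decide = (\<lambda>V c h. if length h < R then None else Some (D (card (all_facilities V)) V h)) \<rparr>"
  have A: "send A V c h v = S (card (all_facilities V)) V h v"
    "decide A V c h = (if length h < R then None else Some (D (card (all_facilities V)) V h))"
    for V c h v by (simp_all add: A_def)
  have "bandwidth_at_most A I (B n) \<and> halted A I \<omega> R \<and> solution A I \<omega> R =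
      ({j \<in> clients I. K n I (Inr j)}, {i \<in> facilities I. K n I (Inl i)})"
    if n: "n \<ge> 1" and I: "I \<in> \<I> n" for n I \<omega>
  proof -
    have run: "run A I \<omega> t v = (hist (S n) I t v,
        if t < R then None else Some (D n (initial_view I v) (hist (S n) I t v)))" if "t \<le> R" for t v
      using that
    proof (induction t arbitrary: v)
      case 0
      then show ?case using card[OF I] by (simp add: decision_def A Let_def)
    next
      case (Suc t)
      then have IH: "run A I \<omega> t u = (hist (S n) I t u, None)" for u by simp
      show ?case using card[OF I]
        by (simp add: IH Let_def message_to_def decision_def A cong: if_cong)
    qed
    have "length (message_to A I \<omega> (run A I \<omega> t) u v) \<le> B n" for \<omega> t u v
      using S[OF n] card[OF I] by (simp add: message_to_def A Let_def)
    then have "bandwidth_at_most A I (B n)" by (simp add: bandwidth_at_most_def)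
    moreover have "snd (run A I \<omega> R v) = Some (K n I v)" if "v \<in> nodes I" for v
      using run[of R v] D[OF n I that] by simp
    ultimately show ?thesis
      by (auto simp: halted_def solution_def)
  qed
  then show ?thesis by blast
qed

section \<open>Radii of facilities\<close>

text \<open>The payment that a facility with distances \<open>D\<close> collects from its ball of
  radius \<open>r\<close>. When all penalties are at least \<open>r\<close>, this is the classical
  Mettu-Plaxton sum; in general a client acts as if the radius were at most its penalty.\<close>

definition ball_sum :: "nat set \<Rightarrow> (nat \<Rightarrow> real) \<Rightarrow> (nat \<Rightarrow> real) \<Rightarrow> real \<Rightarrow> real" where
  "ball_sum C p D r = (\<Sum>j\<in>C. max 0 (min (p j) r - D j))"

text \<open>Powers of two replace the exact solution of \<open>ball_sum C p D r = f\<close>, so that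
  distinct positive radii differ by a factor of at least 2.\<close>

definition critical :: "nat set \<Rightarrow> (nat \<Rightarrow> real) \<Rightarrow> (nat \<Rightarrow> real) \<Rightarrow> real \<Rightarrow> int \<Rightarrow> bool" where
  "critical C p D f k \<longleftrightarrow> f \<le> ball_sum C p D (2 powi k) \<and> ball_sum C p D (2 powi (k - 1)) < f"

text \<open>The value \<open>-1\<close> stands for an infinite radius.\<close>
definition radius :: "nat set \<Rightarrow> (nat \<Rightarrow> real) \<Rightarrow> (nat \<Rightarrow> real) \<Rightarrow> real \<Rightarrow> real" where
  "radius C p D f = (if f = 0 then 0
     else if \<exists>k. critical C p D f k then 2 powi (SOME k. critical C p D f k) else - 1)"

lemma radius_cong:
  assumes "\<And>j. j \<in> C \<Longrightarrow> p j = p' j" "\<And>j. j \<in> C \<Longrightarrow> D j = D' j"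
  shows "radius C p D f = radius C p' D' f"
proof -
  have "ball_sum C p D r = ball_sum C p' D' r" for r
    unfolding ball_sum_def using assms by (intro sum.cong) auto
  then have eq: "critical C p D f = critical C p' D' f"
    by (simp add: critical_def fun_eq_iff)
  show ?thesis unfolding radius_def eq by (rule refl)
qed

lemma ball_sum_nonneg: "0 \<le> ball_sum C p D r"
  by (simp add: ball_sum_def sum_nonneg)

lemma ball_sum_mono: "r \<le> r' \<Longrightarrow> ball_sum C p D r \<le> ball_sum C p D r'"
  unfolding ball_sum_def by (intro sum_mono) auto

lemma ball_sum_le:
  assumes "\<And>j. j \<in> C \<Longrightarrow> 0 \<le> D j" "0 \<le> r"
  shows "ball_sum C p D r \<le> real (card C) * r"
proof -
  have "ball_sum C p D r \<le> (\<Sum>j\<in>C. r)"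
    unfolding ball_sum_def using assms by (intro sum_mono) (fastforce simp: max_def min_def)
  then show ?thesis by simp
qed

lemma radius_cases:
  obtains (zero) "f = 0" "radius C p D f = 0"
  | (power) k where "f \<noteq> 0" "critical C p D f k" "radius C p D f = 2 powi k"
  | (infinite) "f \<noteq> 0" "\<And>k. \<not> critical C p D f k" "radius C p D f = - 1"
  by (metis radius_def someI_ex)

lemma ball_sum_radius_ge: "0 \<le> radius C p D f \<Longrightarrow> f \<le> ball_sum C p D (radius C p D f)"
  by (cases C p D f rule: radius_cases) (auto simp: critical_def ball_sum_nonneg)

lemma ball_sum_half_radius_le:
  assumes "0 \<le> radius C p D f" "\<And>j. j \<in> C \<Longrightarrow> 0 \<le> D j"
  shows "ball_sum C p D (radius C p D f / 2) \<le> f"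
proof (cases C p D f rule: radius_cases)
  case zero
  then show ?thesis using ball_sum_le[of C D 0 p] assms(2) by simp
next
  case (power k)
  have "(2::real) powi k / 2 = 2 powi (k - 1)" by (simp add: power_int_diff)
  then show ?thesis using power by (simp add: critical_def)
qed (use assms in simp)

text \<open>\<open>ball_sum\<close> tends to 0 with \<open>r\<close>. If it exceeded a positive
  \<open>f\<close> anywhere, it would reach \<open>f\<close> between two consecutive powers of two,
  and the larger one would be critical.\<close>

lemma ball_sum_infinite_radius_le:
  assumes "radius C p D f < 0" "0 \<le> f" "\<And>j. j \<in> C \<Longrightarrow> 0 \<le> D j"
  shows "ball_sum C p D r \<le> f"
proof (cases C p D f rule: radius_cases)
  case infinite
  show ?thesis
  proof (rule ccontr)
    assume "\<not> ?thesis"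
    then have r: "f < ball_sum C p D r" by simp
    have f: "0 < f" using infinite assms(2) by simp
    obtain a :: nat where a: "r < 2 ^ a" using real_arch_pow[of 2 r] by auto
    have "0 < f / (real (card C) + 1)" using f by simp
    then obtain b :: nat where b: "(1 / 2) ^ b < f / (real (card C) + 1)"
      using real_arch_pow_inv[of _ "1 / 2 :: real"] by auto
    have low: "ball_sum C p D (2 powi (- int b)) < f"
    proof -
      have "ball_sum C p D (2 powi (- int b)) \<le> real (card C) * (1 / 2) ^ b"
      proof -
        have "(2::real) powi (- int b) = (1 / 2) ^ b"
          by (simp add: power_int_minus power_one_over inverse_eq_divide)
        then show ?thesis using ball_sum_le[of C D "2 powi (- int b)" p] assms(3) by simp
      qed
      also have "\<dots> \<le> (real (card C) + 1) * (1 / 2) ^ b" by (intro mult_right_mono) auto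
      also have "\<dots> < f" using b by (simp add: field_simps)
      finally show ?thesis .
    qed
    define P where "P = (\<lambda>m. f \<le> ball_sum C p D (2 powi (int m - int b)))"
    have "P (a + b)"
      using r ball_sum_mono[of r "2 ^ a" C p D] a by (simp add: P_def)
    moreover have "\<not> P 0" using low by (simp add: P_def)
    ultimately obtain m where "\<not> P m" "P (Suc m)"
      using dec_induct[of 0 "a + b" "\<lambda>m. \<not> P m"] by auto
    then have "critical C p D f (int (Suc m) - int b)"
      by (simp add: P_def critical_def)
    then show False using infinite by blast
  qed
next
  case (power k)
  have "\<not> (2::real) powi k < 0" by (simp add: not_less)
  then show ?thesis using power assms(1) by simp
qed (use assms in simp)

text \<open>An alphabet for announcing radii. Exponents may be arbitrarily large, since nothing
  bounds the magnitude of the numbers in \<open>Q\<close>; but a positive radius is within a factor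
  \<open>N\<close> or 4 of one of these numbers, which leaves few exponents for each.\<close>

definition radii :: "nat \<Rightarrow> real set \<Rightarrow> real set" where
  "radii N Q = {- 1, 0} \<union> (\<Union>y\<in>Q. (\<lambda>k. 2 powi k) ` {k :: int. 0 < y \<and> y \<le> real N * 2 powi k \<and> 2 powi k \<le> 4 * y})"

text \<open>Some client's payment grows between \<open>r / 2\<close> and \<open>r\<close>, so
  \<open>r / 2 < p j\<close> and \<open>D j < r\<close>. Then \<open>p j\<close> is comparable with
  \<open>r\<close> if it is at most \<open>r\<close>, and \<open>D j\<close> is if it exceeds
  \<open>r / 4\<close>. In the remaining case the client already pays \<open>r / 4\<close> at
  \<open>r / 2\<close>, and \<open>f\<close> is comparable with \<open>r\<close>.\<close>

lemma radius_in_radii: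
  assumes "f \<in> Q" "p ` C \<subseteq> Q" "D ` C \<subseteq> Q" "0 \<le> f" "\<And>j. j \<in> C \<Longrightarrow> 0 \<le> D j"
    and C: "1 \<le> card C"
  shows "radius C p D f \<in> radii (card C) Q"
proof (cases C p D f rule: radius_cases)
  case (power k)
  define r where "r = (2 :: real) powi k"
  have r: "0 < r" by (simp add: r_def)
  have half: "(2 :: real) powi (k - 1) = r / 2" by (simp add: r_def power_int_diff)
  have lt: "ball_sum C p D (r / 2) < ball_sum C p D r" and fr: "f \<le> ball_sum C p D r"
    and f2: "ball_sum C p D (r / 2) < f"
    using power by (auto simp: critical_def half r_def)
  obtain j where j: "j \<in> C" "max 0 (min (p j) (r / 2) - D j) < max 0 (min (p j) r - D j)"
    using lt unfolding ball_sum_def by (meson sum_mono not_less)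
  have pj: "r / 2 < p j" and Dj: "D j < r" using j(2) by (auto simp: max_def min_def split: if_splits)
  have CC: "r \<le> real (card C) * r" using C r by simp
  have "\<exists>y\<in>Q. 0 < y \<and> y \<le> real (card C) * r \<and> r \<le> 4 * y"
  proof (cases "p j \<le> r")
    case True
    show ?thesis using pj r order_trans[OF True CC] assms(2) j(1) by (intro bexI[of _ "p j"]) auto
  next
    case pr: False
    show ?thesis
    proof (cases "r / 4 < D j")
      case True
      then show ?thesis using order_trans[OF less_imp_le[OF Dj] CC] r assms(3) j(1) by (intro bexI[of _ "D j"]) auto
    next
      case False
      have finC: "finite C" using C card.infinite by fastforce
      have "r / 4 \<le> max 0 (min (p j) (r / 2) - D j)" using False pr r by (auto simp: min_def)
      also have "\<dots> \<le> ball_sum C p D (r / 2)"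
        unfolding ball_sum_def using finC j(1) by (intro member_le_sum) auto
      finally have "r / 4 < f" using f2 by simp
      moreover have "f \<le> real (card C) * r"
        using fr ball_sum_le[of C D r p] assms(5) r by force
      ultimately show ?thesis using r assms(1) by (intro bexI[of _ f]) auto
    qed
  qed
  then show ?thesis using power(3) by (auto simp: radii_def r_def)
qed (auto simp: radii_def)

lemma card_radii:
  assumes "finite Q" "1 \<le> N"
  shows "finite (radii N Q)" "card (radii N Q) \<le> 2 + card Q * (16 * N)"
proof -
  define T where "T = (\<lambda>y. {k :: int. 0 < y \<and> y \<le> real N * 2 powi k \<and> 2 powi k \<le> 4 * y})"
  have T: "finite (T y) \<and> card (T y) \<le> 16 * N" for y
  proof (cases "T y = {}")
    case False
    then obtain k where k: "k \<in> T y" by blast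
    \<comment> \<open>Both powers are compared with the same \<open>y\<close>, whence
      \<open>2 ^ (k' - k'') \<le> 4 * N\<close>. Replacing the logarithm by \<open>4 * N\<close> is
      crude, but costs only \<open>O(log N)\<close> bits in an encoding.\<close>
    have le: "k' \<le> k'' + 4 * int N" if "k' \<in> T y" "k'' \<in> T y" for k' k''
    proof (rule ccontr)
      assume "\<not> ?thesis"
      then have gt: "4 * N < nat (k' - k'')" "k'' < k'" by auto
      have "2 powi k' \<le> 4 * (real N * 2 powi k'')" using that by (auto simp: T_def)
      then have "(2::real) powi (k' - k'') \<le> 4 * real N" by (simp add: power_int_diff field_simps)
      then have "(2::real) ^ nat (k' - k'') \<le> real (4 * N)"
        using gt(2) by (simp add: power_int_def)
      then have "2 ^ nat (k' - k'') \<le> 4 * N"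
        by (metis of_nat_le_iff of_nat_numeral of_nat_power)
      then show False using gt(1) less_exp[of "nat (k' - k'')"] by linarith
    qed
    have sub: "T y \<subseteq> {k - 4 * int N..k + 4 * int N}"
    proof
      fix k' assume "k' \<in> T y"
      then show "k' \<in> {k - 4 * int N..k + 4 * int N}" using le[OF k] le[OF _ k] by fastforce
    qed
    have "card (T y) \<le> card {k - 4 * int N..k + 4 * int N}" by (intro card_mono sub) simp
    also have "\<dots> \<le> 16 * N" using assms(2) by simp
    finally show ?thesis using sub finite_subset by blast
  qed simp
  have eq: "radii N Q = {- 1, 0} \<union> (\<Union>y\<in>Q. (\<lambda>k. 2 powi k) ` T y)" by (simp add: radii_def T_def)
  show "finite (radii N Q)" unfolding eq using assms(1) T by auto
  have "card (radii N Q) \<le> card {- 1, 0 :: real} + card (\<Union>y\<in>Q. (\<lambda>k. 2 powi k :: real) ` T y)"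
    unfolding eq by (rule card_Un_le)
  also have "card (\<Union>y\<in>Q. (\<lambda>k. 2 powi k :: real) ` T y) \<le> (\<Sum>y\<in>Q. card ((\<lambda>k. 2 powi k :: real) ` T y))"
    by (rule card_UN_le[OF assms(1)])
  also have "\<dots> \<le> (\<Sum>y\<in>Q. 16 * N)"
    using T by (intro sum_mono) (meson card_image_le order_trans)
  finally show "card (radii N Q) \<le> 2 + card Q * (16 * N)" by simp
qed

section \<open>Approximation guarantee\<close>

definition rad :: "flp \<Rightarrow> nat \<Rightarrow> real" where
  "rad I i = radius (clients I) (penalty I) (\<lambda>j. distance I j i) (opening_cost I i)"

definition eligible :: "flp \<Rightarrow> nat set" where
  "eligible I = {i \<in> facilities I. 0 \<le> rad I i \<and>
     (\<forall>u\<in>facilities I. 0 \<le> rad I u \<and> rad I u < rad I i \<longrightarrow> 2 * rad I i < distance I u i)}"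

text \<open>For \<open>c = 2\<close> these are the neighbours in \<open>G\<close> together with
  \<open>i\<close>. As all members have the same radius, the factors \<open>c\<close> add up along
  walks.\<close>

definition near :: "real \<Rightarrow> flp \<Rightarrow> nat \<Rightarrow> nat set" where
  "near c I i = {u \<in> eligible I. rad I u = rad I i \<and> distance I u i \<le> c * rad I i}"

text \<open>Plays the part of a dual variable: the estimates sum to at most 3 times the optimum, and
  the constructed solution is charged to them.\<close>

definition estimate :: "flp \<Rightarrow> nat \<Rightarrow> real" where
  "estimate I j = Min (insert (penalty I j)
     ((\<lambda>i. rad I i + distance I i j) ` {i \<in> facilities I. 0 \<le> rad I i}))"

lemma rad_halving:
  assumes "0 \<le> rad I i" "rad I i < rad I u"
  shows "rad I i \<le> rad I u / 2"
proof -
  have "0 < rad I u" using assms by linarith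
  then obtain k where k: "rad I u = 2 powi k"
    unfolding rad_def by (metis less_irrefl neg_0_less_iff_less not_one_less_zero radius_cases)
  consider "rad I i = 0" | l where "rad I i = 2 powi l"
    using assms(1) unfolding rad_def by (metis neg_0_le_iff_le not_one_le_zero radius_cases)
  then show ?thesis
  proof cases
    case (2 l)
    then have "l < k" using assms(2) k power_int_increasing[of k l "2::real"] by force
    then have "(2::real) powi l \<le> 2 powi (k - 1)" by (intro power_int_increasing) auto
    then show ?thesis using 2 k by (simp add: power_int_diff)
  qed (use \<open>0 < rad I u\<close> in simp)
qed

locale flp_context =
  fixes n :: nat and I :: flp
  assumes inst: "flp_instance n I"
begin

abbreviation "F \<equiv> facilities I"
abbreviation "C \<equiv> clients I"
abbreviation "d \<equiv> distance I"
abbreviation "\<rho> \<equiv> rad I"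
abbreviation "E \<equiv> eligible I"

lemma finite_F [simp]: "finite F" and finite_C [simp]: "finite C"
  using inst finite_subset by (auto simp: flp_instance_def)

lemma card_F: "card F = n" and card_C: "card C = n"
  and F_sub: "F \<subseteq> {..<2 * n}"
  using inst by (auto simp: flp_instance_def)

lemma opening_nonneg: "i \<in> F \<Longrightarrow> 0 \<le> opening_cost I i"
  and penalty_nonneg: "j \<in> C \<Longrightarrow> 0 \<le> penalty I j"
  using inst by (auto simp: flp_instance_def)

sublocale Metric_space "F \<union> C" d
  using inst by (simp add: flp_instance_def)

lemma E_sub: "E \<subseteq> F" and finite_E [simp]: "finite E"
  using finite_subset[of E F] by (auto simp: eligible_def)

lemma rad_E_nonneg: "i \<in> E \<Longrightarrow> 0 \<le> \<rho> i"
  by (simp add: eligible_def)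

lemma opening_le_ball_sum:
  "0 \<le> \<rho> i \<Longrightarrow> opening_cost I i \<le> ball_sum C (penalty I) (\<lambda>j. d j i) (\<rho> i)"
  unfolding rad_def by (rule ball_sum_radius_ge)

lemma ball_sum_half_le:
  "0 \<le> \<rho> i \<Longrightarrow> ball_sum C (penalty I) (\<lambda>j. d j i) (\<rho> i / 2) \<le> opening_cost I i"
  unfolding rad_def by (rule ball_sum_half_radius_le) auto

section \<open>Estimates as a lower bound on the optimum\<close>

lemma estimate_le_penalty: "estimate I j \<le> penalty I j"
  and estimate_le: "i \<in> F \<Longrightarrow> 0 \<le> \<rho> i \<Longrightarrow> estimate I j \<le> \<rho> i + d i j"
  unfolding estimate_def by (auto intro!: Min_le)

lemma estimate_cases:
  obtains "estimate I j = penalty I j"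
  | i where "i \<in> F" "0 \<le> \<rho> i" "estimate I j = \<rho> i + d i j"
proof -
  have "estimate I j \<in> insert (penalty I j) ((\<lambda>i. \<rho> i + d i j) ` {i \<in> F. 0 \<le> \<rho> i})"
    unfolding estimate_def by (rule Min_in) auto
  then show ?thesis using that by auto
qed

lemma estimate_nonneg: "j \<in> C \<Longrightarrow> 0 \<le> estimate I j"
  by (cases j rule: estimate_cases) (auto simp: penalty_nonneg)

text \<open>With \<open>r = \<rho> i / 2\<close> the payments to \<open>i\<close> are at most its
  opening cost, and \<open>max (d i j) (min (penalty I j) r)\<close> is the distance plus the
  payment. The factor 3 comes from \<open>\<rho> i + d i j = 2 * r + d i j\<close>. For an infinite
  radius, any \<open>r\<close> above all penalties serves.\<close>

lemma estimate_star:
  assumes i: "i \<in> F" and J: "J \<subseteq> C"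
  shows "(\<Sum>j\<in>J. estimate I j) \<le> 3 * (opening_cost I i + (\<Sum>j\<in>J. d i j))"
proof -
  have "\<exists>r. ball_sum C (penalty I) (\<lambda>j. d j i) r \<le> opening_cost I i \<and>
      (\<forall>j\<in>C. estimate I j \<le> 3 * max (d i j) (min (penalty I j) r))"
  proof (cases "0 \<le> \<rho> i")
    case True
    have "estimate I j \<le> 3 * max (d i j) (min (penalty I j) (\<rho> i / 2))" if "j \<in> C" for j
      using estimate_le_penalty[of j] estimate_le[OF i True, of j] penalty_nonneg[OF that]
        nonneg[of i j] True by (auto simp: max_def min_def)
    then show ?thesis using ball_sum_half_le[OF True] by blast
  next
    case False
    define r where "r = (\<Sum>j\<in>C. penalty I j)"
    have "penalty I j \<le> r" if "j \<in> C" for j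
      unfolding r_def using that penalty_nonneg by (intro member_le_sum) auto
    then have "estimate I j \<le> 3 * max (d i j) (min (penalty I j) r)" if "j \<in> C" for j
      using that estimate_le_penalty[of j] penalty_nonneg[OF that] by (fastforce simp: max_def min_def)
    moreover have "ball_sum C (penalty I) (\<lambda>j. d j i) r \<le> opening_cost I i"
      using False opening_nonneg[OF i] unfolding rad_def
      by (intro ball_sum_infinite_radius_le) auto
    ultimately show ?thesis by blast
  qed
  then obtain r where r: "ball_sum C (penalty I) (\<lambda>j. d j i) r \<le> opening_cost I i"
    "\<forall>j\<in>C. estimate I j \<le> 3 * max (d i j) (min (penalty I j) r)" by blast
  have "(\<Sum>j\<in>J. estimate I j) \<le> (\<Sum>j\<in>J. 3 * (d i j + max 0 (min (penalty I j) r - d j i)))"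
  proof (rule sum_mono)
    fix j assume "j \<in> J"
    then have "estimate I j \<le> 3 * max (d i j) (min (penalty I j) r)" using r(2) J by auto
    moreover have "max (d i j) t = d i j + max 0 (t - d i j)" for t by (simp add: max_def)
    ultimately show "estimate I j \<le> 3 * (d i j + max 0 (min (penalty I j) r - d j i))"
      by (simp add: commute[of j i])
  qed
  also have "\<dots> = 3 * ((\<Sum>j\<in>J. d i j) + (\<Sum>j\<in>J. max 0 (min (penalty I j) r - d j i)))"
    by (simp add: sum_distrib_left sum.distrib)
  also have "(\<Sum>j\<in>J. max 0 (min (penalty I j) r - d j i)) \<le> ball_sum C (penalty I) (\<lambda>j. d j i) r"
    unfolding ball_sum_def using J by (intro sum_mono2) auto
  finally show ?thesis using r(1) by simp
qed

lemma dist_to_set_attained: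
  assumes "finite S" "S \<noteq> {}"
  obtains i where "i \<in> S" "dist_to_set I j S = ereal (d i j)"
proof -
  have "(INF i\<in>S. ereal (d i j)) \<in> (\<lambda>i. ereal (d i j)) ` S"
    using assms by (subst Min_Inf[symmetric]) (auto intro!: Min_in)
  then show ?thesis using that by (auto simp: dist_to_set_def)
qed

lemma dist_to_set_le: "i \<in> S \<Longrightarrow> dist_to_set I j S \<le> ereal (d i j)"
  unfolding dist_to_set_def by (rule INF_lower)

text \<open>The served clients are split into stars around their closest open facilities, and the
  other clients are compared with their penalties.\<close>

lemma estimate_le_cost:
  assumes C': "C' \<subseteq> C" and F': "F' \<subseteq> F"
  shows "ereal (\<Sum>j\<in>C. estimate I j) \<le> 3 * cost I (C', F')"
proof (cases "\<exists>j\<in>C'. dist_to_set I j F' = \<infinity>")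
  case True
  have fin: "finite C'" "finite F'" using assms finite_subset finite_F finite_C by blast+
  have "(\<Sum>j\<in>C'. dist_to_set I j F') = \<infinity>"
    using True fin by (simp add: sum_Pinfty)
  moreover have "0 \<le> (\<Sum>i\<in>F'. ereal (opening_cost I i))" "0 \<le> (\<Sum>j\<in>C - C'. ereal (penalty I j))"
    using F' opening_nonneg penalty_nonneg by (auto intro!: sum_nonneg)
  ultimately have "cost I (C', F') = \<infinity>" by (simp add: cost_def)
  then show ?thesis by simp
next
  case False
  have fin: "finite C'" "finite F'" using assms finite_subset finite_F finite_C by blast+
  have "\<exists>i\<in>F'. dist_to_set I j F' = ereal (d i j)" if j: "j \<in> C'" for j
  proof -
    have "F' \<noteq> {}" using False j by (auto simp: dist_to_set_def top_ereal_def)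
    then show ?thesis using dist_to_set_attained[OF fin(2)] by metis
  qed
  then obtain a where a: "\<And>j. j \<in> C' \<Longrightarrow> a j \<in> F'"
    "\<And>j. j \<in> C' \<Longrightarrow> dist_to_set I j F' = ereal (d (a j) j)" by metis
  have group: "(\<Sum>i\<in>F'. \<Sum>j | j \<in> C' \<and> a j = i. h j) = sum h C'" for h :: "nat \<Rightarrow> real"
    using fin a(1) by (intro sum.group) auto
  have "(\<Sum>j\<in>C'. estimate I j) = (\<Sum>i\<in>F'. \<Sum>j | j \<in> C' \<and> a j = i. estimate I j)"
    by (simp only: group)
  also have "\<dots> \<le> (\<Sum>i\<in>F'. 3 * (opening_cost I i + (\<Sum>j | j \<in> C' \<and> a j = i. d i j)))"
    using F' C' by (intro sum_mono estimate_star) auto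
  also have "\<dots> = 3 * ((\<Sum>i\<in>F'. opening_cost I i) + (\<Sum>i\<in>F'. \<Sum>j | j \<in> C' \<and> a j = i. d (a j) j))"
    by (simp add: sum_distrib_left[symmetric] sum.distrib)
  also have "(\<Sum>i\<in>F'. \<Sum>j | j \<in> C' \<and> a j = i. d (a j) j) = (\<Sum>j\<in>C'. d (a j) j)"
    by (rule group)
  finally have 1: "(\<Sum>j\<in>C'. estimate I j) \<le> 3 * ((\<Sum>i\<in>F'. opening_cost I i) + (\<Sum>j\<in>C'. d (a j) j))" .
  have 2: "(\<Sum>j\<in>C - C'. estimate I j) \<le> 3 * (\<Sum>j\<in>C - C'. penalty I j)"
    unfolding sum_distrib_left
  proof (rule sum_mono)
    fix j assume "j \<in> C - C'"
    then show "estimate I j \<le> 3 * penalty I j"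
      using estimate_le_penalty[of j] penalty_nonneg[of j] by simp
  qed
  have "(\<Sum>j\<in>C. estimate I j) = (\<Sum>j\<in>C - C'. estimate I j) + (\<Sum>j\<in>C'. estimate I j)"
    using C' by (intro sum.subset_diff) auto
  with 1 2 have le: "(\<Sum>j\<in>C. estimate I j) \<le>
      3 * ((\<Sum>i\<in>F'. opening_cost I i) + (\<Sum>j\<in>C'. d (a j) j) + (\<Sum>j\<in>C - C'. penalty I j))"
    by simp
  have cost: "cost I (C', F') =
      ereal ((\<Sum>i\<in>F'. opening_cost I i) + (\<Sum>j\<in>C'. d (a j) j) + (\<Sum>j\<in>C - C'. penalty I j))"
    using a(2) by (simp add: cost_def)
  show ?thesis
    unfolding cost numeral_eq_ereal times_ereal.simps(1) ereal_less_eq(3) by (rule le)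
qed

lemma estimate_le_min_cost: "ereal (\<Sum>j\<in>C. estimate I j) \<le> 3 * min_cost I"
proof -
  have "min_cost I \<in> cost I ` (Pow C \<times> Pow F)"
    unfolding min_cost_def by (intro Min_in) auto
  then show ?thesis using estimate_le_cost by auto
qed

text \<open>An ineligible facility is blocked by one of at most half its radius within
  \<open>2 * \<rho> i\<close>. Following the blockers gives
  \<open>2 * \<rho> i + 4 * (\<rho> i / 2) = 4 * \<rho> i\<close>.\<close>

lemma eligible_nearby:
  assumes "i \<in> F" "0 \<le> \<rho> i"
  shows "\<exists>e\<in>E. \<rho> e \<le> \<rho> i \<and> d e i \<le> 4 * \<rho> i"
  using assms
proof (induction "card {u \<in> F. 0 \<le> \<rho> u \<and> \<rho> u < \<rho> i}" arbitrary: i rule: less_induct)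
  case less
  show ?case
  proof (cases "i \<in> E")
    case True
    then show ?thesis using less.prems by (intro bexI[of _ i]) auto
  next
    case False
    then obtain u where u: "u \<in> F" "0 \<le> \<rho> u" "\<rho> u < \<rho> i" "d u i \<le> 2 * \<rho> i"
      using less.prems by (auto simp: eligible_def not_less)
    have "{w \<in> F. 0 \<le> \<rho> w \<and> \<rho> w < \<rho> u} \<subset> {w \<in> F. 0 \<le> \<rho> w \<and> \<rho> w < \<rho> i}"
      using u by auto
    then have "card {w \<in> F. 0 \<le> \<rho> w \<and> \<rho> w < \<rho> u} < card {w \<in> F. 0 \<le> \<rho> w \<and> \<rho> w < \<rho> i}"
      by (intro psubset_card_mono) auto
    from less.hyps[OF this u(1,2)] obtain e where e: "e \<in> E" "\<rho> e \<le> \<rho> u" "d e u \<le> 4 * \<rho> u"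
      by blast
    have "d e i \<le> d e u + d u i"
      using e(1) u(1) less.prems(1) E_sub by (intro triangle) auto
    also have "\<dots> \<le> 4 * \<rho> i" using rad_halving[OF u(2,3)] e(3) u(4) by simp
    finally show ?thesis using e(1,2) u(3) by (intro bexI[of _ e]) auto
  qed
qed

text \<open>
  A facility with \<open>\<rho> u < \<rho> i\<close> is farther than \<open>2 \<rho> i\<close> from an eligible \<open>i\<close>, hence
  too far from the clients in the ball of \<open>i\<close> to have a smaller estimate.
\<close>
lemma eligible_contribution_le:
  assumes i: "i \<in> E" and j: "j \<in> C" "d j i < \<rho> i"
  shows "min (penalty I j) (\<rho> i) \<le> estimate I j"
proof (cases j rule: estimate_cases)
  case (2 u)
  show ?thesis
  proof (cases "\<rho> u < \<rho> i")
    case True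
    have iF: "i \<in> F" using i E_sub by blast
    have "2 * \<rho> i < d u i" using i True 2 by (auto simp: eligible_def)
    also have "\<dots> \<le> d u j + d j i" using 2 iF j(1) by (intro triangle) auto
    finally show ?thesis using 2 j(2) by simp
  next
    case False
    then have "\<rho> i \<le> \<rho> u + d u j" using nonneg[of u j] by linarith
    then show ?thesis using 2 by simp
  qed
qed simp

text \<open>Every facility in \<open>S\<close> is paid for by the clients in its ball. Independence
  lets each client pay to at most one of them, and no more than its estimate.\<close>

lemma opening_le_estimate:
  assumes S: "S \<subseteq> E" and indep: "\<And>i u. i \<in> S \<Longrightarrow> u \<in> S \<Longrightarrow> u \<in> near 2 I i \<Longrightarrow> u = i"
  shows "(\<Sum>i\<in>S. opening_cost I i) \<le> (\<Sum>j\<in>C. estimate I j)"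
proof -
  have finS: "finite S" using S finite_E finite_subset by blast
  have "(\<Sum>i\<in>S. opening_cost I i) \<le> (\<Sum>i\<in>S. ball_sum C (penalty I) (\<lambda>j. d j i) (\<rho> i))"
    using S rad_E_nonneg by (intro sum_mono opening_le_ball_sum) auto
  also have "\<dots> = (\<Sum>j\<in>C. \<Sum>i\<in>S. max 0 (min (penalty I j) (\<rho> i) - d j i))"
    unfolding ball_sum_def by (rule sum.swap)
  also have "\<dots> \<le> (\<Sum>j\<in>C. estimate I j)"
  proof (rule sum_mono)
    fix j assume j: "j \<in> C"
    define h where "h = (\<lambda>i. max 0 (min (penalty I j) (\<rho> i) - d j i))"
    show "(\<Sum>i\<in>S. h i) \<le> estimate I j"
    proof (cases "\<exists>i\<in>S. h i \<noteq> 0")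
      case False
      then show ?thesis using estimate_nonneg[OF j] by simp
    next
      case True
      then obtain i where i: "i \<in> S" "h i \<noteq> 0" by blast
      have di: "d j u < \<rho> u" if "h u \<noteq> 0" for u
        using that by (auto simp: h_def max_def min_def split: if_splits)
      have "h u = 0" if u: "u \<in> S - {i}" for u
      proof (rule ccontr)
        assume hu: "h u \<noteq> 0"
        have iE: "i \<in> E" "i \<in> F" and uE: "u \<in> E" "u \<in> F" using u i S E_sub by auto
        have "d u i \<le> d u j + d j i" using iE uE j by (intro triangle) auto
        \<comment> \<open>The balls intersect, so the distance is below twice the larger radius;
          eligibility then forces the radii to be equal.\<close>
        then have ui: "d u i < \<rho> u + \<rho> i" using di[OF hu] di[OF i(2)] commute[of u j] by simp
        have "\<not> \<rho> u < \<rho> i" using iE uE ui by (auto simp: eligible_def)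
        moreover have "\<not> \<rho> i < \<rho> u"
        proof
          assume "\<rho> i < \<rho> u"
          then have "2 * \<rho> u < d i u" using iE uE by (auto simp: eligible_def)
          then show False using ui \<open>\<rho> i < \<rho> u\<close> commute[of i u] by simp
        qed
        ultimately have "u \<in> near 2 I i" using ui uE by (simp add: near_def)
        then show False using indep[OF i(1)] u by auto
      qed
      then have "(\<Sum>i\<in>S. h i) = h i"
        using i(1) finS by (simp add: sum.remove[of S i])
      also have "\<dots> = min (penalty I j) (\<rho> i) - d j i"
        using i(2) by (auto simp: h_def max_def split: if_splits)
      also have "\<dots> \<le> min (penalty I j) (\<rho> i)"
        using nonneg[of j i] by linarith
      also have "\<dots> \<le> estimate I j"
        using i S j di by (intro eligible_contribution_le) auto
      finally show ?thesis .
    qed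
  qed
  finally show ?thesis .
qed

text \<open>A client reaches an eligible facility at the price of 4 radii and a member of
  \<open>S\<close> at the price of 10 more, so its cost is at most 14 estimates. Opening costs one
  estimate per client, and the estimates cost a factor 3.\<close>

lemma cost_le_min_cost:
  assumes S: "S \<subseteq> E" and indep: "\<And>i u. i \<in> S \<Longrightarrow> u \<in> S \<Longrightarrow> u \<in> near 2 I i \<Longrightarrow> u = i"
    and cover: "\<And>i. i \<in> E \<Longrightarrow> \<exists>s\<in>S. d s i \<le> 10 * \<rho> i"
  shows "cost I ({j \<in> C. dist_to_set I j S \<le> ereal (penalty I j)}, S) \<le> ereal 45 * min_cost I"
proof -
  define C' where "C' = {j \<in> C. dist_to_set I j S \<le> ereal (penalty I j)}"
  have near_S: "estimate I j = penalty I j \<or> dist_to_set I j S \<le> ereal (14 * estimate I j)"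
    if j: "j \<in> C" for j
  proof (cases j rule: estimate_cases)
    case (2 i)
    obtain e where e: "e \<in> E" "\<rho> e \<le> \<rho> i" "d e i \<le> 4 * \<rho> i"
      using eligible_nearby[OF 2(1,2)] by blast
    obtain s where s: "s \<in> S" "d s e \<le> 10 * \<rho> e" using cover[OF e(1)] by blast
    have F: "s \<in> F" "e \<in> F" using s(1) e(1) S E_sub by auto
    have "d s j \<le> d s i + d i j" using F 2(1) j by (intro triangle) auto
    moreover have "d s i \<le> d s e + d e i" using F 2(1) by (intro triangle) auto
    ultimately have "d s j \<le> 14 * \<rho> i + d i j" using e(2,3) s(2) by linarith
    moreover have "d i j \<le> 14 * d i j" using mult_right_mono[of 1 14 "d i j"] by simp
    ultimately have "d s j \<le> 14 * estimate I j" unfolding 2(3) distrib_left by linarith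
    then show ?thesis using dist_to_set_le[OF s(1), of j] by (meson ereal_less_eq(3) order_trans)
  qed simp
  have "(\<Sum>i\<in>S. ereal (opening_cost I i)) \<le> ereal (\<Sum>j\<in>C. estimate I j)"
    using opening_le_estimate[OF S indep] by simp
  moreover have "(\<Sum>j\<in>C'. dist_to_set I j S) \<le> (\<Sum>j\<in>C'. ereal (14 * estimate I j))"
  proof (rule sum_mono)
    fix j assume "j \<in> C'"
    then have j: "j \<in> C" "dist_to_set I j S \<le> ereal (penalty I j)" by (auto simp: C'_def)
    have "ereal (estimate I j) \<le> ereal (14 * estimate I j)" using estimate_nonneg[OF j(1)] by simp
    then show "dist_to_set I j S \<le> ereal (14 * estimate I j)"
      using near_S[OF j(1)] j(2) by (metis order_trans)
  qed
  moreover have "(\<Sum>j\<in>C - C'. ereal (penalty I j)) \<le> (\<Sum>j\<in>C - C'. ereal (14 * estimate I j))"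
  proof (rule sum_mono)
    fix j assume "j \<in> C - C'"
    then have j: "j \<in> C" "ereal (penalty I j) < dist_to_set I j S" by (auto simp: C'_def)
    have "penalty I j \<le> 14 * penalty I j" using penalty_nonneg[OF j(1)] by simp
    then show "ereal (penalty I j) \<le> ereal (14 * estimate I j)"
      using near_S[OF j(1)] j(2) by (metis ereal_less_eq(3) less_imp_le order_trans)
  qed
  ultimately have "cost I (C', S) \<le> ereal (\<Sum>j\<in>C. estimate I j) +
      (\<Sum>j\<in>C'. ereal (14 * estimate I j)) + (\<Sum>j\<in>C - C'. ereal (14 * estimate I j))"
    unfolding cost_def prod.case by (intro add_mono)
  also have "\<dots> = ereal ((\<Sum>j\<in>C. estimate I j) + ((\<Sum>j\<in>C - C'. 14 * estimate I j) + (\<Sum>j\<in>C'. 14 * estimate I j)))"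
    by (simp add: add_ac)
  also have "(\<Sum>j\<in>C - C'. 14 * estimate I j) + (\<Sum>j\<in>C'. 14 * estimate I j) = (\<Sum>j\<in>C. 14 * estimate I j)"
    by (rule sum.subset_diff[symmetric]) (auto simp: C'_def)
  also have "ereal ((\<Sum>j\<in>C. estimate I j) + (\<Sum>j\<in>C. 14 * estimate I j)) = 15 * ereal (\<Sum>j\<in>C. estimate I j)"
    by (simp add: sum_distrib_left[symmetric])
  also have "\<dots> \<le> 15 * (3 * min_cost I)"
    by (intro ereal_mult_left_mono estimate_le_min_cost) simp
  also have "\<dots> = ereal 45 * min_cost I"
    by (simp add: mult.assoc[symmetric])
  finally show ?thesis by (simp add: C'_def)
qed

end

section \<open>Facilities opened by the algorithm\<close>

lemma card_bounded_subsets: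
  assumes "finite U"
  shows "finite {A. A \<subseteq> U \<and> card A \<le> m}" "card {A. A \<subseteq> U \<and> card A \<le> m} \<le> (card U + 1) ^ m"
proof -
  define L where "L = {xs. set xs \<subseteq> insert None (Some ` U) \<and> length xs = m}"
  have L: "finite L" "card L = (card U + 1) ^ m"
    using assms by (simp_all add: L_def finite_lists_length_eq card_lists_length_eq card_image)
  have "{A. A \<subseteq> U \<and> card A \<le> m} \<subseteq> (\<lambda>xs. {a. Some a \<in> set xs}) ` L"
  proof
    fix A assume "A \<in> {A. A \<subseteq> U \<and> card A \<le> m}"
    then have A: "A \<subseteq> U" "card A \<le> m" "finite A" using assms finite_subset by auto
    obtain ys where ys: "set ys = A" "length ys = card A"
      using finite_distinct_list[OF A(3)] distinct_card by metis
    define xs where "xs = map Some ys @ replicate (m - card A) None"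
    have "xs \<in> L" "{a. Some a \<in> set xs} = A" using ys A by (auto simp: L_def xs_def)
    then show "A \<in> (\<lambda>xs. {a. Some a \<in> set xs}) ` L" by blast
  qed
  then show "finite {A. A \<subseteq> U \<and> card A \<le> m}" "card {A. A \<subseteq> U \<and> card A \<le> m} \<le> (card U + 1) ^ m"
    using finite_subset[OF _ finite_imageI[OF L(1)]] surj_card_le[OF L(1)] L(2) by simp_all
qed

text \<open>\<open>SOME\<close> makes the same choice at every node, so nodes that know the values
  of \<open>W\<close> on \<open>A\<close> agree without communication.\<close>

definition best :: "('a \<Rightarrow> nat) \<Rightarrow> 'a set \<Rightarrow> 'a" where
  "best W A = (SOME x. x \<in> A \<and> (\<forall>y\<in>A. W x \<le> W y))"

lemma best:
  assumes "finite A" "A \<noteq> {}"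
  shows "best W A \<in> A" "card A * W (best W A) \<le> sum W A"
proof -
  have "\<exists>x. x \<in> A \<and> (\<forall>y\<in>A. W x \<le> W y)"
    using ex_min_if_finite[of "W ` A"] assms by (fastforce simp: not_less)
  then have *: "best W A \<in> A \<and> (\<forall>y\<in>A. W (best W A) \<le> W y)"
    unfolding best_def by (rule someI_ex)
  then show "best W A \<in> A" "card A * W (best W A) \<le> sum W A"
    using sum_bounded_below[of A "W (best W A)" W] by auto
qed

lemma best_cong: "(\<And>x. x \<in> A \<Longrightarrow> W x = W' x) \<Longrightarrow> best W A = best W' A"
  unfolding best_def by (rule arg_cong[of _ _ Eps]) (auto simp: fun_eq_iff)

text \<open>\<open>P\<close> is meant to contain loops, so that members of \<open>S\<close> are
  dominated by themselves.\<close>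

definition maximal_independent :: "'a set \<Rightarrow> 'a rel \<Rightarrow> 'a set \<Rightarrow> bool" where
  "maximal_independent V P S \<longleftrightarrow> S \<subseteq> V \<and> (\<forall>i\<in>S. \<forall>u\<in>S. (i, u) \<in> P \<longrightarrow> u = i) \<and>
     (\<forall>i\<in>V. \<exists>s\<in>S. (i, s) \<in> P)"

definition mis :: "'a set \<Rightarrow> 'a rel \<Rightarrow> 'a set" where
  "mis V P = (SOME S. maximal_independent V P S)"

lemma mis:
  assumes "finite V" "sym P" "\<And>i. i \<in> V \<Longrightarrow> (i, i) \<in> P"
  shows "maximal_independent V P (mis V P)"
proof -
  have "\<exists>S. maximal_independent V P S"
    using assms(1,3)
  proof (induction V rule: finite_induct)
    case (insert x V)
    then obtain S where S: "maximal_independent V P S" by auto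
    show ?case
    proof (cases "\<exists>s\<in>S. (x, s) \<in> P")
      case True
      then have "maximal_independent (insert x V) P S" using S by (auto simp: maximal_independent_def)
      then show ?thesis by blast
    next
      case False
      then have "(s, x) \<notin> P" if "s \<in> S" for s using that assms(2) by (auto dest: symD)
      then have "maximal_independent (insert x V) P (insert x S)"
        using S False insert.prems by (auto simp: maximal_independent_def)
      then show ?thesis by blast
    qed
  qed (auto simp: maximal_independent_def)
  then show ?thesis unfolding mis_def by (rule someI_ex)
qed

text \<open>Items of one residue class are told apart by their quotients, of which there are
  \<open>c\<close>. This deals out the edges evenly to \<open>n\<close> nodes.\<close>

lemma card_mod_class_le:
  assumes "inj_on g P" "g ` P \<subseteq> {..<c * n}" "0 < n"
  shows "card {p \<in> P. g p mod n = r} \<le> c"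
proof -
  have "card {p \<in> P. g p mod n = r} \<le> card {..<c}"
  proof (rule card_inj_on_le)
    show "inj_on (\<lambda>p. g p div n) {p \<in> P. g p mod n = r}"
    proof (rule inj_onI)
      fix p q assume pq: "p \<in> {p \<in> P. g p mod n = r}" "q \<in> {p \<in> P. g p mod n = r}" "g p div n = g q div n"
      then have "g p = g q" using div_mult_mod_eq[of "g p" n] div_mult_mod_eq[of "g q" n] by auto
      then show "p = q" using assms(1) pq by (auto dest: inj_onD)
    qed
    show "(\<lambda>p. g p div n) ` {p \<in> P. g p mod n = r} \<subseteq> {..<c}"
      using assms(2,3) by (auto simp: less_mult_imp_div_less)
  qed simp
  then show ?thesis by simp
qed

text \<open>The position of \<open>(i, u)\<close> in the lexicographic order of all edges. The
  degrees \<open>a\<close> are separate from the set \<open>A\<close> because everybody knows the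
  former, but only node \<open>i\<close> knows its own \<open>A\<close>; this lets \<open>i\<close>
  number its edges by itself.\<close>

definition index_of :: "nat set \<Rightarrow> (nat \<Rightarrow> nat) \<Rightarrow> nat set \<Rightarrow> nat \<Rightarrow> nat \<Rightarrow> nat" where
  "index_of V a A i u = (\<Sum>w | w \<in> V \<and> w < i. a w) + card {w \<in> A. w < u}"

lemma index_of:
  assumes V: "finite V" and A: "\<And>i. i \<in> V \<Longrightarrow> finite (A i)" and a: "\<And>i. i \<in> V \<Longrightarrow> a i = card (A i)"
  shows "inj_on (\<lambda>(i, u). index_of V a (A i) i u) (Sigma V A)"
    and "(\<lambda>(i, u). index_of V a (A i) i u) ` Sigma V A \<subseteq> {..<\<Sum>i\<in>V. a i}"
proof -
  define s where "s = (\<lambda>i. \<Sum>w | w \<in> V \<and> w < i. a w)"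
  have less: "index_of V a (A i) i u < s i + a i" if "i \<in> V" "u \<in> A i" for i u
    using psubset_card_mono[of "A i" "{w \<in> A i. w < u}"] A[OF that(1)] that a[OF that(1)]
    by (auto simp: index_of_def s_def)
  have step: "s i + a i \<le> (\<Sum>w\<in>W. a w)" if "i \<in> W" "W \<subseteq> V" "{w \<in> V. w < i} \<subseteq> W" for i W
  proof -
    have "s i + a i = (\<Sum>w\<in>insert i {w \<in> V. w < i}. a w)" using V by (simp add: s_def)
    also have "\<dots> \<le> (\<Sum>w\<in>W. a w)" using that V finite_subset by (intro sum_mono2) auto
    finally show ?thesis .
  qed
  have le: "s i + a i \<le> s i'" if "i \<in> V" "i < i'" for i i'
  proof -
    have "{w \<in> V. w < i} \<subseteq> {w \<in> V. w < i'}" using that by auto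
    then show ?thesis using step[of i "{w \<in> V. w < i'}"] that by (simp add: s_def)
  qed
  have ge: "s i \<le> index_of V a (A i) i u" for i u by (simp add: index_of_def s_def)
  have aux: "False" if "i \<in> V" "u \<in> A i" "i < i'"
    "index_of V a (A i) i u = index_of V a (A i') i' u'" for i u i' u'
    using less[OF that(1,2)] le[OF that(1,3)] ge[of i' u'] that(4) by linarith
  have aux2: "False" if "i \<in> V" "u \<in> A i" "u < u'"
    "index_of V a (A i) i u = index_of V a (A i) i u'" for i u u'
  proof -
    have "card {w \<in> A i. w < u} < card {w \<in> A i. w < u'}"
      by (rule psubset_card_mono) (use that A in auto)
    then show False using that(4) by (simp add: index_of_def)
  qed
  show "inj_on (\<lambda>(i, u). index_of V a (A i) i u) (Sigma V A)"
  proof (rule inj_onI, clarify)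
    fix i u i' u' assume *: "i \<in> V" "u \<in> A i" "i' \<in> V" "u' \<in> A i'"
      "index_of V a (A i) i u = index_of V a (A i') i' u'"
    have "i = i'" using aux[of i u i' u'] aux[of i' u' i u] * by (metis linorder_neqE_nat)
    moreover from this have "u = u'" using aux2[of i u u'] aux2[of i u' u] * by (metis linorder_neqE_nat)
    ultimately show "i = i' \<and> u = u'" by simp
  qed
  show "(\<lambda>(i, u). index_of V a (A i) i u) ` Sigma V A \<subseteq> {..<\<Sum>i\<in>V. a i}"
    using less step[of _ V] by (force dest: order_less_le_trans)
qed

section \<open>The selected sample and the sparsified graph\<close>

definition near_rel :: "real \<Rightarrow> flp \<Rightarrow> nat rel" where
  "near_rel c I = {(i, u). i \<in> eligible I \<and> u \<in> near c I i}"

definition degree :: "flp \<Rightarrow> nat \<Rightarrow> nat" where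
  "degree I i = card (near 2 I i)"

definition sampled :: "flp \<Rightarrow> (nat \<Rightarrow> nat) \<Rightarrow> nat set" where
  "sampled I g = sample (2 * card (facilities I)) (eligible I) (degree I) g"

definition node_load :: "flp \<Rightarrow> (nat \<Rightarrow> nat) \<Rightarrow> nat \<Rightarrow> nat" where
  "node_load I g i = (if i \<in> eligible I then load (near 2 I i) (near 8 I i) (sampled I g) i else 0)"

definition kept :: "flp \<Rightarrow> (nat \<Rightarrow> nat) \<Rightarrow> nat set" where
  "kept I g = {i \<in> eligible I. i \<in> sampled I g \<or> near 8 I i \<inter> sampled I g = {}}"

text \<open>Depends on the set of facilities alone, so every node knows it from the start. Triples
  of facilities supply the \<open>n^3\<close> indices.\<close>

definition family :: "nat set \<Rightarrow> nat \<times> nat \<times> nat \<Rightarrow> nat \<Rightarrow> nat" where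
  "family F = (SOME Fam. \<forall>N H. graph_pair (2 * card F) N H \<longrightarrow>
     (\<Sum>k\<in>F \<times> F \<times> F. real (total_load (2 * card F) N H (Fam k))) \<le> 38 * real (2 * card F) * real (card F ^ 3))"

text \<open>The method of conditional expectations, with facilities as digits so that facility
  \<open>x\<close> can be in charge of option \<open>x\<close>. The sum over \<open>i\<close> is
  outermost because each node evaluates the inner sums locally.\<close>

definition digit1 :: "flp \<Rightarrow> nat" where
  "digit1 I = best (\<lambda>x. \<Sum>i\<in>facilities I. \<Sum>y\<in>facilities I. \<Sum>z\<in>facilities I.
     node_load I (family (facilities I) (x, y, z)) i) (facilities I)"

definition digit2 :: "flp \<Rightarrow> nat" where
  "digit2 I = best (\<lambda>y. \<Sum>i\<in>facilities I. \<Sum>z\<in>facilities I.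
     node_load I (family (facilities I) (digit1 I, y, z)) i) (facilities I)"

definition digit3 :: "flp \<Rightarrow> nat" where
  "digit3 I = best (\<lambda>z. \<Sum>i\<in>facilities I.
     node_load I (family (facilities I) (digit1 I, digit2 I, z)) i) (facilities I)"

definition chosen :: "flp \<Rightarrow> nat \<Rightarrow> nat" where
  "chosen I = family (facilities I) (digit1 I, digit2 I, digit3 I)"

definition core :: "flp \<Rightarrow> nat set" where
  "core I = kept I (chosen I)"

definition core_rel :: "flp \<Rightarrow> nat rel" where
  "core_rel I = Sigma (core I) (\<lambda>i. near 2 I i \<inter> core I)"

definition opened :: "flp \<Rightarrow> nat set" where
  "opened I = mis (core I) (core_rel I)"

context flp_context
begin

lemma near_sub: "near c I i \<subseteq> E" by (auto simp: near_def)

lemma finite_near [simp]: "finite (near c I i)"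
  using near_sub finite_E finite_subset by blast

lemma near_refl: "i \<in> E \<Longrightarrow> 0 \<le> c \<Longrightarrow> i \<in> near c I i"
  using E_sub rad_E_nonneg by (auto simp: near_def)

lemma near_commute: "i \<in> E \<Longrightarrow> u \<in> near c I i \<Longrightarrow> i \<in> near c I u"
  by (simp add: near_def commute)

lemma near_trans:
  assumes "i \<in> E" "u \<in> near a I i" "w \<in> near b I u"
  shows "w \<in> near (a + b) I i"
proof -
  have "i \<in> F \<union> C" "u \<in> F \<union> C" "w \<in> F \<union> C" using assms near_sub E_sub by blast+
  then have "d w i \<le> d w u + d u i" by (intro triangle)
  then show ?thesis using assms by (simp add: near_def distrib_right)
qed

lemma near_rel_Image: "i \<in> E \<Longrightarrow> near_rel c I `` {i} = near c I i"
  by (auto simp: near_rel_def)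

lemma Domain_near_rel: "0 \<le> c \<Longrightarrow> Domain (near_rel c I) = E"
  using near_refl by (auto simp: near_rel_def)

lemma graph_pair_near: "graph_pair (2 * n) (near_rel 2 I) (near_rel 8 I)"
proof -
  have E: "E \<subseteq> {..<2 * n}" using E_sub F_sub by blast
  have sub: "near_rel c I \<subseteq> E \<times> E" for c using near_sub by (auto simp: near_rel_def)
  have comp: "near_rel a I O near_rel b I \<subseteq> near_rel (a + b) I" for a b
    using near_trans by (auto simp: near_rel_def)
  have "near_rel 2 I O near_rel 2 I O near_rel 2 I O near_rel 2 I \<subseteq> near_rel 8 I"
  proof -
    have "near_rel 2 I O near_rel 2 I O near_rel 2 I O near_rel 2 I \<subseteq>
        near_rel 2 I O near_rel 2 I O near_rel 4 I"
      using comp[of 2 2] by (intro relcomp_mono) auto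
    also have "\<dots> \<subseteq> near_rel 2 I O near_rel 6 I"
      using comp[of 2 4] by (intro relcomp_mono) auto
    also have "\<dots> \<subseteq> near_rel 8 I" using comp[of 2 6] by simp
    finally show ?thesis .
  qed
  moreover have "sym (near_rel 2 I)"
  proof (rule symI)
    fix i u assume "(i, u) \<in> near_rel 2 I"
    then have iu: "i \<in> E" "u \<in> near 2 I i" by (auto simp: near_rel_def)
    then have "u \<in> E" "i \<in> near 2 I u" using near_sub near_commute by blast+
    then show "(u, i) \<in> near_rel 2 I" by (simp add: near_rel_def)
  qed
  moreover have "near_rel 2 I \<subseteq> {..<2 * n} \<times> {..<2 * n}"
    by (rule order_trans[OF sub Sigma_mono[OF E E]])
  moreover have "Domain (near_rel 2 I) = E" by (rule Domain_near_rel) simp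
  moreover have "(i, i) \<in> near_rel 2 I" if "i \<in> E" for i
    using that near_refl[OF that, of 2] by (simp add: near_rel_def)
  ultimately show ?thesis
    using sub[of 8] by (simp add: graph_pair_def)
qed

lemma sum_node_load: "(\<Sum>i\<in>F. node_load I g i) = total_load (2 * n) (near_rel 2 I) (near_rel 8 I) g"
proof -
  have s: "sample (2 * n) E (\<lambda>u. card (near_rel 2 I `` {u})) g = sampled I g"
    by (auto simp: sample_def sampled_def degree_def near_rel_Image card_F)
  have "(\<Sum>i\<in>F. node_load I g i) = (\<Sum>i\<in>E. node_load I g i)"
    using E_sub by (intro sum.mono_neutral_right) (auto simp: node_load_def)
  also have "\<dots> = total_load (2 * n) (near_rel 2 I) (near_rel 8 I) g"
    by (simp add: total_load_def Domain_near_rel near_rel_Image s node_load_def)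
  finally show ?thesis .
qed

lemma sum_family_le:
  assumes n: "1 \<le> n"
  shows "(\<Sum>x\<in>F. \<Sum>y\<in>F. \<Sum>z\<in>F. \<Sum>i\<in>F. node_load I (family F (x, y, z)) i) \<le> 76 * n * n ^ 3"
proof -
  have card: "card (F \<times> F \<times> F) = n ^ 3"
    by (simp add: card_cartesian_product card_F power3_eq_cube)
  \<comment> \<open>With \<open>m = 2 * n\<close> and \<open>n ^ 3\<close> indices,
    \<open>m ^ 3 \<le> 8 * card K\<close> holds with equality.\<close>
  have "\<exists>Fam. \<forall>N H. graph_pair (2 * card F) N H \<longrightarrow>
     (\<Sum>k\<in>F \<times> F \<times> F. real (total_load (2 * card F) N H (Fam k))) \<le> 38 * real (2 * card F) * real (card F ^ 3)"
    using good_family[of "F \<times> F \<times> F" "2 * n"] n card by (auto simp: card_F power_mult_distrib)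
  then have "\<forall>N H. graph_pair (2 * card F) N H \<longrightarrow>
     (\<Sum>k\<in>F \<times> F \<times> F. real (total_load (2 * card F) N H (family F k))) \<le> 38 * real (2 * card F) * real (card F ^ 3)"
    unfolding family_def by (rule someI_ex)
  then have "(\<Sum>k\<in>F \<times> F \<times> F. real (\<Sum>i\<in>F. node_load I (family F k) i)) \<le> 38 * real (2 * n) * real (n ^ 3)"
    using graph_pair_near by (simp only: sum_node_load card_F)
  then have "real (\<Sum>k\<in>F \<times> F \<times> F. \<Sum>i\<in>F. node_load I (family F k) i) \<le> real (76 * n * n ^ 3)"
    by simp
  then have "(\<Sum>k\<in>F \<times> F \<times> F. \<Sum>i\<in>F. node_load I (family F k) i) \<le> 76 * n * n ^ 3"
    by (simp only: of_nat_le_iff)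
  moreover have "sum h (F \<times> F \<times> F) = (\<Sum>x\<in>F. \<Sum>y\<in>F. \<Sum>z\<in>F. h (x, y, z))" for h :: "_ \<Rightarrow> nat"
    by (simp add: sum.cartesian_product split_def)
  ultimately show ?thesis by simp
qed

text \<open>Each stage takes a minimum over \<open>n\<close> options and so divides the bound
  \<open>76 * n * n ^ 3\<close> by \<open>n\<close>.\<close>

lemma chosen_load:
  assumes n: "1 \<le> n"
  shows "(\<Sum>i\<in>F. node_load I (chosen I) i) \<le> 76 * n"
proof -
  have F: "finite F" "F \<noteq> {}" using n card_F by auto
  define W1 where "W1 = (\<lambda>x. \<Sum>i\<in>F. \<Sum>y\<in>F. \<Sum>z\<in>F. node_load I (family F (x, y, z)) i)"
  define W2 where "W2 = (\<lambda>y. \<Sum>i\<in>F. \<Sum>z\<in>F. node_load I (family F (digit1 I, y, z)) i)"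
  define W3 where "W3 = (\<lambda>z. \<Sum>i\<in>F. node_load I (family F (digit1 I, digit2 I, z)) i)"
  have W: "W1 x = (\<Sum>y\<in>F. \<Sum>z\<in>F. \<Sum>i\<in>F. node_load I (family F (x, y, z)) i)" for x
    unfolding W1_def by (subst sum.swap, rule sum.cong[OF refl], rule sum.swap)
  have W': "W1 (digit1 I) = sum W2 F" unfolding W1_def W2_def by (rule sum.swap)
  have W'': "W2 (digit2 I) = sum W3 F" unfolding W2_def W3_def by (rule sum.swap)
  have "n * W1 (digit1 I) \<le> sum W1 F"
    using best(2)[OF F, of W1] by (simp add: digit1_def W1_def card_F)
  also have "\<dots> \<le> 76 * n * n ^ 3" unfolding W by (rule sum_family_le[OF n])
  finally have 1: "n * W1 (digit1 I) \<le> 76 * n * n ^ 3" .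
  have 2: "n * W2 (digit2 I) \<le> W1 (digit1 I)"
    using best(2)[OF F, of W2] unfolding W' by (simp add: digit2_def W2_def card_F)
  have 3: "n * W3 (digit3 I) \<le> W2 (digit2 I)"
    using best(2)[OF F, of W3] unfolding W'' by (simp add: digit3_def W3_def card_F)
  have "n ^ 3 * W3 (digit3 I) = n * (n * (n * W3 (digit3 I)))" by (simp add: power3_eq_cube)
  also have "\<dots> \<le> n * (n * W2 (digit2 I))" using 3 by simp
  also have "\<dots> \<le> n * W1 (digit1 I)" using 2 by simp
  also have "\<dots> \<le> n ^ 3 * (76 * n)" using 1 by (simp add: mult_ac)
  finally have "W3 (digit3 I) \<le> 76 * n" using n by simp
  then show ?thesis by (simp add: W3_def chosen_def)
qed

lemma core_sub: "core I \<subseteq> E" and finite_core [simp]: "finite (core I)"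
  using finite_subset[OF _ finite_E, of "core I"] by (auto simp: core_def kept_def)

text \<open>A core neighbour of a sampled vertex has that vertex in its ball, hence is in the core
  only as a sampled vertex itself. An unsampled core vertex is uncovered, and its load is its full
  degree.\<close>

lemma sum_core_degree:
  assumes n: "1 \<le> n"
  shows "(\<Sum>i\<in>core I. card (near 2 I i \<inter> core I)) \<le> 76 * n"
proof -
  define X where "X = sampled I (chosen I)"
  have "card (near 2 I i \<inter> core I) \<le> node_load I (chosen I) i" if i: "i \<in> core I" for i
  proof (cases "i \<in> X")
    case True
    have "near 2 I i \<inter> core I \<subseteq> near 2 I i \<inter> X"
    proof
      fix u assume u: "u \<in> near 2 I i \<inter> core I"
      have "i \<in> near 2 I u" using u i core_sub near_commute by blast
      moreover have "0 \<le> rad I u" using u near_sub rad_E_nonneg by blast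
      ultimately have "i \<in> near 8 I u" by (auto simp: near_def)
      then show "u \<in> near 2 I i \<inter> X" using u True by (auto simp: core_def kept_def X_def)
    qed
    then have "card (near 2 I i \<inter> core I) \<le> card (near 2 I i \<inter> X)" by (intro card_mono) auto
    then show ?thesis using True i core_sub by (auto simp: node_load_def load_def X_def)
  next
    case False
    then have "node_load I (chosen I) i = card (near 2 I i)"
      using i by (auto simp: node_load_def load_def X_def core_def kept_def)
    then show ?thesis by (simp add: card_mono)
  qed
  then have "(\<Sum>i\<in>core I. card (near 2 I i \<inter> core I)) \<le> (\<Sum>i\<in>core I. node_load I (chosen I) i)"
    by (rule sum_mono)
  also have "\<dots> \<le> (\<Sum>i\<in>F. node_load I (chosen I) i)"
    using core_sub E_sub by (intro sum_mono2) auto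
  finally show ?thesis using chosen_load[OF n] by simp
qed

lemma opened_properties:
  shows "opened I \<subseteq> E" and "\<And>i u. i \<in> opened I \<Longrightarrow> u \<in> opened I \<Longrightarrow> u \<in> near 2 I i \<Longrightarrow> u = i"
    and "\<And>i. i \<in> E \<Longrightarrow> \<exists>s\<in>opened I. d s i \<le> 10 * \<rho> i"
proof -
  have "sym (core_rel I)"
    using core_sub near_commute by (auto simp: sym_def core_rel_def)
  moreover have "(i, i) \<in> core_rel I" if "i \<in> core I" for i
    using that core_sub near_refl[of i 2] by (auto simp: core_rel_def)
  ultimately have mis: "maximal_independent (core I) (core_rel I) (opened I)"
    unfolding opened_def by (intro mis) auto
  then have sub: "opened I \<subseteq> core I" by (auto simp: maximal_independent_def)
  then show "opened I \<subseteq> E" using core_sub by blast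
  show "u = i" if "i \<in> opened I" "u \<in> opened I" "u \<in> near 2 I i" for i u
    using mis that sub unfolding maximal_independent_def core_rel_def by blast
  have close: "\<exists>s\<in>opened I. s \<in> near 2 I i" if "i \<in> core I" for i
    using mis that by (fastforce simp: maximal_independent_def core_rel_def)
  show "\<exists>s\<in>opened I. d s i \<le> 10 * \<rho> i" if i: "i \<in> E" for i
  proof -
    have "\<exists>x\<in>core I. x \<in> near 8 I i"
    proof (cases "near 8 I i \<inter> sampled I (chosen I) = {}")
      case True
      then show ?thesis using i near_refl[OF i, of 8] by (auto simp: core_def kept_def)
    next
      case False
      then show ?thesis using near_sub by (auto simp: core_def kept_def)
    qed
    then obtain x where x: "x \<in> core I" "x \<in> near 8 I i" by blast
    from close[OF x(1)] obtain s where s: "s \<in> opened I" "s \<in> near 2 I x" by blast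
    have "s \<in> near 10 I i" using near_trans[OF i x(2) s(2)] by simp
    then show ?thesis using s(1) by (auto simp: near_def)
  qed
qed

lemma opened_cost:
  "cost I ({j \<in> C. dist_to_set I j (opened I) \<le> ereal (penalty I j)}, opened I) \<le> ereal 45 * min_cost I"
  by (rule cost_le_min_cost) (use opened_properties in auto)

end

section \<open>Distributed implementation\<close>

lemma row_initial_view [simp]:
  "u \<in> facilities I \<union> clients I \<Longrightarrow> row (initial_view I (Inl i)) u = distance I u i"
  "u \<in> facilities I \<union> clients I \<Longrightarrow> row (initial_view I (Inr i)) u = distance I u i"
  by (auto simp: initial_view_def)

lemma weight_initial_view [simp]:
  "weight (initial_view I (Inl i)) = opening_cost I i"
  "weight (initial_view I (Inr j)) = penalty I j"
  by (auto simp: initial_view_def)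

text \<open>Fixes the residue class of edge indices for which a facility is responsible.\<close>

definition facility_number :: "nat set \<Rightarrow> nat \<Rightarrow> nat" where
  "facility_number F = (SOME r. bij_betw r F {..<card F})"

lemma facility_number: "finite F \<Longrightarrow> bij_betw (facility_number F) F {..<card F}"
  unfolding facility_number_def atLeast0LessThan[symmetric] by (rule someI_ex[OF ex_bij_betw_finite_nat])

text \<open>Equals \<open>near\<close> at the node hosting facility \<open>i\<close>, whose row
  holds the distances to \<open>i\<close>.\<close>

definition near_view :: "real \<Rightarrow> (nat \<Rightarrow> real) \<Rightarrow> nat set \<Rightarrow> view \<Rightarrow> nat \<Rightarrow> nat set" where
  "near_view c r E V i = {u \<in> E. r u = r i \<and> row V u \<le> c * r i}"

definition load_view :: "nat set \<Rightarrow> (nat \<Rightarrow> real) \<Rightarrow> nat set \<Rightarrow> (nat \<Rightarrow> nat) \<Rightarrow> view \<Rightarrow> (nat \<Rightarrow> nat) \<Rightarrow> nat" where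
  "load_view F r E dg V g = (case self V of Inl i \<Rightarrow>
     (if i \<in> E then load (near_view 2 r E V i) (near_view 8 r E V i) (sample (2 * card F) E dg g) i else 0)
   | Inr j \<Rightarrow> 0)"

lemma nodes_sum:
  assumes "finite (facilities I)" "finite (clients I)"
  shows "sum h (nodes I) = (\<Sum>i\<in>facilities I. h (Inl i)) + (\<Sum>j\<in>clients I. h (Inr j))"
  unfolding nodes_def using assms by (simp add: sum.Plus)

lemma common_network:
  assumes "common \<I> B R G"
  shows "common \<I> B R (\<lambda>I. ((facilities I, clients I), G I))"
  unfolding common_def
  by (rule computable_mono[OF assms[unfolded common_def], of _
        "\<lambda>(V, g). (V, (all_facilities V, all_clients V), g)"]) simp

lemma common_broadcast':
  assumes G: "common \<I> B R G" and Q: "finite Q" "card Q \<le> 2 ^ B"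
    and x: "\<And>I u. I \<in> \<I> \<Longrightarrow> u \<in> nodes I \<Longrightarrow> x (initial_view I u) (G I) \<in> Q"
    and G': "\<And>I. I \<in> \<I> \<Longrightarrow>
      G' I = \<phi> (facilities I) (G I) (restrict (\<lambda>u. x (initial_view I u) (G I)) (nodes I))"
  shows "common \<I> B (Suc R) G'"
proof -
  have "common \<I> B (Suc R) (\<lambda>I. (((facilities I, clients I), G I),
      restrict (\<lambda>u. (\<lambda>V p. x V (snd p)) (initial_view I u) ((facilities I, clients I), G I)) (nodes I)))"
    by (rule common_broadcast[OF common_network[OF G] Q]) (simp add: x)
  then show ?thesis
    by (rule common_mono[where \<phi> = "\<lambda>(((F, C), g), y). \<phi> F g y"]) (simp add: G')
qed

text \<open>Node \<open>Inl x\<close> adds up the values of option \<open>x\<close> and announces the sum.\<close>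
lemma common_best:
  fixes G :: "flp \<Rightarrow> 'g"
  assumes G: "common \<I> B R G"
    and fin: "\<And>I. I \<in> \<I> \<Longrightarrow> card (nodes I) = N"
    and w: "\<And>I u x. I \<in> \<I> \<Longrightarrow> u \<in> nodes I \<Longrightarrow> x \<in> facilities I \<Longrightarrow> w (initial_view I u) (G I) x \<le> W"
    and B: "W + 1 \<le> 2 ^ B" "N * W + 1 \<le> 2 ^ B"
    and G': "\<And>I. I \<in> \<I> \<Longrightarrow> G' I =
      (G I, best (\<lambda>x. \<Sum>u\<in>nodes I. w (initial_view I u) (G I) x) (facilities I))"
  shows "common \<I> B (R + 2) G'"
proof -
  define G1 where "G1 = (\<lambda>I. ((facilities I, clients I), G I))"
  define x where "x = (\<lambda>V (p :: (nat set \<times> nat set) \<times> 'g) v. case v of Inl i \<Rightarrow> w V (snd p) i | Inr (j::nat) \<Rightarrow> 0)"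
  define y where "y = (\<lambda>(p :: (nat set \<times> nat set) \<times> 'g) (z :: node \<Rightarrow> nat).
    \<Sum>u\<in>fst (fst p) <+> snd (fst p). z u)"
  have "common \<I> B (R + 2) (\<lambda>I. (G1 I, restrict (\<lambda>v. y (G1 I)
      (restrict (\<lambda>u. x (initial_view I u) (G1 I) v) (nodes I))) (nodes I)))"
  proof (rule common_relay[where G = G1 and x = x and y = y and Q = "{..W}" and Q' = "{..N * W}"])
    show "common \<I> B R G1" unfolding G1_def by (rule common_network[OF G])
    show "x (initial_view I u) (G1 I) v \<in> {..W}" if "I \<in> \<I>" "u \<in> nodes I" "v \<in> nodes I" for I u v
      using that w by (cases v) (auto simp: x_def G1_def)
    show "y (G1 I) (restrict (\<lambda>u. x (initial_view I u) (G1 I) v) (nodes I)) \<in> {..N * W}"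
      if I: "I \<in> \<I>" and v: "v \<in> nodes I" for I v
    proof (cases v)
      case (Inl i)
      have "(\<Sum>u\<in>nodes I. w (initial_view I u) (G I) i) \<le> (\<Sum>u\<in>nodes I. W)"
        using I v Inl by (intro sum_mono w) auto
      then show ?thesis using fin[OF I] Inl by (simp add: y_def x_def G1_def nodes_def[symmetric])
    qed (simp add: y_def x_def G1_def nodes_def[symmetric])
  qed (use B in auto)
  then show ?thesis
    by (rule common_mono[where \<phi> = "\<lambda>(((F, C), g), t). (g, best (\<lambda>x. t (Inl x)) F)"])
      (simp add: G' G1_def y_def x_def nodes_def[symmetric] cong: best_cong)
qed

text \<open>
  Messages are given by finite alphabets. The largest one consists of the sets of at most 77 edges,
  each of which takes \<open>2 (l + 1)\<close> bits if \<open>n < 2 ^ l\<close>.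
\<close>
definition alphabet_bound :: "nat \<Rightarrow> nat \<Rightarrow> nat" where
  "alphabet_bound k l = k + 154 * (l + 1)"

lemma alphabet_bound:
  fixes n k l :: nat
  assumes "n + 1 \<le> 2 ^ l" "1 \<le> n"
  shows "2 ^ (k + 1) \<le> (2::nat) ^ alphabet_bound k l"
    and "2 + 2 ^ (k + 1) * (16 * n) \<le> 2 ^ alphabet_bound k l"
    and "n + 1 \<le> 2 ^ alphabet_bound k l"
    and "2 * n * n ^ 3 + 1 \<le> 2 ^ alphabet_bound k l"
    and "(2 * n + 1) ^ 77 \<le> 2 ^ alphabet_bound k l"
    and "(2 * n * (2 * n) + 1) ^ 77 \<le> 2 ^ alphabet_bound k l"
proof -
  have le: "(2::nat) ^ a \<le> 2 ^ alphabet_bound k l" if "a \<le> alphabet_bound k l" for a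
    using that by (intro power_increasing) auto
  have n2: "2 * n + 1 \<le> 2 ^ (l + 1)" using assms(1) by simp
  show "2 ^ (k + 1) \<le> (2::nat) ^ alphabet_bound k l" by (rule le) (simp add: alphabet_bound_def)
  have "(2::nat) * 1 \<le> 2 ^ (k + 1)" by simp
  then have "2 + 2 ^ (k + 1) * (16 * n) \<le> 2 ^ (k + 1) * (16 * (n + 1))"
    by (simp add: distrib_left)
  also have "\<dots> \<le> 2 ^ (k + 1) * (2 ^ 4 * 2 ^ l)" using assms(1) by simp
  also have "\<dots> = 2 ^ (k + 1 + 4 + l)" by (simp add: power_add)
  also have "\<dots> \<le> 2 ^ alphabet_bound k l" by (rule le) (simp add: alphabet_bound_def)
  finally show "2 + 2 ^ (k + 1) * (16 * n) \<le> 2 ^ alphabet_bound k l" .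
  show "n + 1 \<le> 2 ^ alphabet_bound k l"
    by (rule order_trans[OF assms(1) le]) (simp add: alphabet_bound_def)
  have pow: "(2 * n + 1) ^ a \<le> 2 ^ alphabet_bound k l" if "a \<le> 154" for a
  proof -
    have "(2 * n + 1) ^ a \<le> (2 ^ (l + 1)) ^ a" using n2 by (rule power_mono) simp
    also have "\<dots> = 2 ^ ((l + 1) * a)" by (rule power_mult[symmetric])
    also have "\<dots> \<le> 2 ^ alphabet_bound k l"
    proof (rule le)
      have "(l + 1) * a \<le> (l + 1) * 154" by (rule mult_left_mono[OF that]) simp
      then show "(l + 1) * a \<le> alphabet_bound k l" by (simp add: alphabet_bound_def)
    qed
    finally show ?thesis .
  qed
  have "2 * n * n ^ 3 + 1 \<le> (2 * n + 1) ^ 4"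
    by (simp add: eval_nat_numeral algebra_simps)
  also have "\<dots> \<le> 2 ^ alphabet_bound k l" by (rule pow) simp
  finally show "2 * n * n ^ 3 + 1 \<le> 2 ^ alphabet_bound k l" .
  show "(2 * n + 1) ^ 77 \<le> 2 ^ alphabet_bound k l" by (rule pow) simp
  have "(2 * n * (2 * n) + 1) ^ 77 \<le> ((2 * n + 1)\<^sup>2) ^ 77"
    by (rule power_mono) (simp_all add: power2_eq_square)
  also have "\<dots> = (2 * n + 1) ^ 154" by (simp add: power_mult[symmetric])
  also have "\<dots> \<le> 2 ^ alphabet_bound k l" by (rule pow) simp
  finally show "(2 * n * (2 * n) + 1) ^ 77 \<le> 2 ^ alphabet_bound k l" .
qed

text \<open>The 14 rounds: one each for penalties, radii, eligibility and degrees, two for each of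
  the three digits, one each for the core and its degrees, and two for collecting and announcing the
  edges of the core.\<close>

lemma computable_opened:
  fixes n k l :: nat and num :: "bool list \<Rightarrow> real"
  defines "\<I> \<equiv> {I. flp_instance n I \<and> numbers_representable num k I}" and "B \<equiv> alphabet_bound k l"
  assumes n: "1 \<le> n" and l: "n + 1 \<le> 2 ^ l"
  shows "computable \<I> B 14 (\<lambda>I v. case v of Inl i \<Rightarrow> i \<in> opened I
    | Inr j \<Rightarrow> dist_to_set I j (opened I) \<le> ereal (penalty I j))"
proof -
  note B = alphabet_bound[OF l n, of k, folded B_def]
  have ctx: "flp_context n I" if "I \<in> \<I>" for I
    using that by (simp add: \<I>_def flp_context_def)
  note facts = flp_context.card_F[OF ctx] flp_context.card_C[OF ctx]
    flp_context.finite_F[OF ctx] flp_context.finite_C[OF ctx] flp_context.E_sub[OF ctx]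
    flp_context.F_sub[OF ctx]
  have card_nodes: "card (nodes I) = 2 * n" if "I \<in> \<I>" for I
    using facts[OF that] by (simp add: nodes_def card_Plus)
  define Q where "Q = num ` {w. length w \<le> k}"
  have lists: "finite {w :: bool list. length w \<le> k}" "card {w :: bool list. length w \<le> k} \<le> 2 ^ (k + 1)"
  proof -
    show "finite {w :: bool list. length w \<le> k}"
      using finite_lists_length_le[of "UNIV :: bool set" k] by simp
    have "card {w :: bool list. length w \<le> k} = (\<Sum>i\<le>k. 2 ^ i)"
      using card_lists_length_le[of "UNIV :: bool set" k] by simp
    also have "\<dots> = 2 ^ (k + 1) - 1" using sum_power2[of "k + 1"] by (simp add: atMost_atLeast0 atLeastLessThanSuc_atLeastAtMost)
    finally show "card {w :: bool list. length w \<le> k} \<le> 2 ^ (k + 1)" by simp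
  qed
  have Q: "finite Q" "card Q \<le> 2 ^ (k + 1)"
    using lists card_image_le[OF lists(1), of num] by (auto simp: Q_def)
  have inQ: "i \<in> facilities I \<Longrightarrow> opening_cost I i \<in> Q" "j \<in> clients I \<Longrightarrow> penalty I j \<in> Q"
    "u \<in> facilities I \<union> clients I \<Longrightarrow> v \<in> facilities I \<union> clients I \<Longrightarrow> distance I u v \<in> Q"
    if "I \<in> \<I>" for I i j u v
    using that unfolding \<I>_def numbers_representable_def Q_def by blast+
  define r where "r = (\<lambda>I. restrict (rad I) (facilities I))"
  have near_view: "near_view c (r I) (eligible I) (initial_view I (Inl i)) i = near c I i"
    if "I \<in> \<I>" "i \<in> facilities I" for c I i
    using facts[OF that(1)] that(2) by (auto simp: near_view_def near_def r_def)
  have near_sub: "near c I i \<subseteq> eligible I" for c I i by (auto simp: near_def)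

  have load_view: "load_view (facilities I) (r I) (eligible I) (\<lambda>i. if i \<in> eligible I then degree I i else 0)
      (initial_view I u) g = (case u of Inl i \<Rightarrow> node_load I g i | Inr j \<Rightarrow> 0)"
    if I: "I \<in> \<I>" "u \<in> nodes I" for I u g
  proof -
    have "sample (2 * card (facilities I)) (eligible I) (\<lambda>i. if i \<in> eligible I then degree I i else 0) g = sampled I g"
      by (auto simp: sample_def sampled_def)
    then show ?thesis
      using I near_view[OF I(1)] by (auto simp: load_view_def node_load_def split: sum.split)
  qed
  have card_near: "card (near c I i \<inter> A) \<le> n" if "I \<in> \<I>" for c I i A
  proof -
    have "card (near c I i \<inter> A) \<le> card (facilities I)"
      using facts[OF that] near_sub[of c I i] by (intro card_mono) auto
    then show ?thesis using facts[OF that] by simp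
  qed
  have node_load_le: "node_load I g i \<le> n" if "I \<in> \<I>" for I g i
    using card_near[OF that, of 2 i UNIV] card_near[OF that, of 2 i "sampled I g"]
    by (simp add: node_load_def load_def)
  have load_view_le: "load_view (facilities I) (r I) (eligible I) (\<lambda>i. if i \<in> eligible I then degree I i else 0)
      (initial_view I u) g \<le> n" if "I \<in> \<I>" "u \<in> nodes I" for I u g
    using load_view[OF that] node_load_le[OF that(1)] by (simp split: sum.split)
  have n3: "n ^ 3 + 1 \<le> 2 ^ B"
    using B(4) n by (metis add_le_mono1 le_trans mult_le_mono1 mult_1 one_le_mult_iff one_le_numeral)
  have bool: "card (UNIV :: bool set) \<le> 2 ^ B"
    using B(3) n by simp

  \<comment> \<open>A facility has the distances in its row; the penalties are all it lacks for its
    radius.\<close>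
  have "common \<I> B (Suc 0) (\<lambda>I. restrict (penalty I) (clients I))"
    by (rule common_broadcast'[OF common_init Q(1), where x = "\<lambda>V g. weight V" and \<phi> = "\<lambda>F g y j. y (Inr j)"])
      (use Q B inQ in \<open>auto simp: nodes_def fun_eq_iff\<close>)
  then have "common \<I> B (Suc (Suc 0)) r"
  proof (rule common_broadcast'[where Q = "radii n Q" and \<phi> = "\<lambda>F g y i. y (Inl i)" and
      x = "\<lambda>V p. case self V of Inl i \<Rightarrow> radius (all_clients V) p (row V) (weight V) | Inr j \<Rightarrow> 0"])
    have rad: "radius (clients I) (restrict (penalty I) (clients I)) (row (initial_view I (Inl i))) (opening_cost I i) = rad I i"
      for I i unfolding rad_def by (rule radius_cong) auto
    show "finite (radii n Q)" by (rule card_radii[OF Q(1) n])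
    have "card (radii n Q) \<le> 2 + card Q * (16 * n)" by (rule card_radii[OF Q(1) n])
    also have "\<dots> \<le> 2 + 2 ^ (k + 1) * (16 * n)" using Q(2) by simp
    finally show "card (radii n Q) \<le> 2 ^ B" using B(2) by linarith
    show "(case self (initial_view I u) of Inl i \<Rightarrow> radius (all_clients (initial_view I u)) (restrict (penalty I) (clients I))
        (row (initial_view I u)) (weight (initial_view I u)) | Inr j \<Rightarrow> 0) \<in> radii n Q"
      if I: "I \<in> \<I>" and u: "u \<in> nodes I" for I u
    proof (cases u)
      case (Inl i)
      interpret flp_context n I by (rule ctx[OF I])
      have "rad I i \<in> radii (card (clients I)) Q"
        unfolding rad_def using inQ[OF I] u Inl opening_nonneg n
        by (intro radius_in_radii) (auto simp: card_C)
      then show ?thesis using Inl by (simp add: rad card_C)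
    qed (simp add: radii_def)
    show "r I = (\<lambda>i. restrict (\<lambda>u. case self (initial_view I u) of
          Inl i \<Rightarrow> radius (all_clients (initial_view I u)) (restrict (penalty I) (clients I))
            (row (initial_view I u)) (weight (initial_view I u)) | Inr j \<Rightarrow> 0) (nodes I) (Inl i))"
      for I by (auto simp: r_def rad fun_eq_iff)
  qed
  then have "common \<I> B (Suc (Suc (Suc 0))) (\<lambda>I. (r I, eligible I))"
  proof (rule common_broadcast'[where Q = UNIV and \<phi> = "\<lambda>F g y. (g, {i \<in> F. y (Inl i)})" and
      x = "\<lambda>V r. case self V of Inl i \<Rightarrow> 0 \<le> r i \<and>
        (\<forall>u\<in>all_facilities V. 0 \<le> r u \<and> r u < r i \<longrightarrow> 2 * r i < row V u) | Inr j \<Rightarrow> False"])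
    show "(r I, eligible I) = (r I, {i \<in> facilities I. restrict (\<lambda>u. case self (initial_view I u) of
          Inl i \<Rightarrow> 0 \<le> r I i \<and> (\<forall>u'\<in>all_facilities (initial_view I u). 0 \<le> r I u' \<and> r I u' < r I i \<longrightarrow>
            2 * r I i < row (initial_view I u) u') | Inr j \<Rightarrow> False) (nodes I) (Inl i)})" for I
      by (auto simp: eligible_def r_def)
  qed (use bool in auto)
  \<comment> \<open>Degrees are replaced by 0 outside the eligible set, where nobody announces them
    and \<open>sample\<close> never looks.\<close>
  then have "common \<I> B (Suc (Suc (Suc (Suc 0))))
      (\<lambda>I. (r I, eligible I, \<lambda>i. if i \<in> eligible I then degree I i else 0))"
  proof (rule common_broadcast'[where Q = "{..n}" and
      \<phi> = "\<lambda>F (r, E) y. (r, E, \<lambda>i. if i \<in> E then y (Inl i) else 0)" and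
      x = "\<lambda>V (r, E). case self V of Inl i \<Rightarrow> if i \<in> E then card (near_view 2 r E V i) else 0 | Inr j \<Rightarrow> 0"])
    show "card {..n} \<le> 2 ^ B" using B(3) by simp
    show "(case (r I, eligible I) of (r, E) \<Rightarrow> case self (initial_view I u) of
        Inl i \<Rightarrow> if i \<in> E then card (near_view 2 r E (initial_view I u) i) else 0 | Inr j \<Rightarrow> 0) \<in> {..n}"
      if I: "I \<in> \<I>" and u: "u \<in> nodes I" for I u
      using near_view[OF I] card_near[OF I, of 2 _ UNIV] u by (auto split: sum.split)
    show "(r I, eligible I, \<lambda>i. if i \<in> eligible I then degree I i else 0) =
      (case (r I, eligible I) of (r', E) \<Rightarrow> \<lambda>y. (r', E, \<lambda>i. if i \<in> E then y (Inl i) else 0))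
        (restrict (\<lambda>u. case (r I, eligible I) of (r, E) \<Rightarrow> case self (initial_view I u) of
        Inl i \<Rightarrow> if i \<in> E then card (near_view 2 r E (initial_view I u) i) else 0 | Inr j \<Rightarrow> 0) (nodes I))"
      if I: "I \<in> \<I>" for I
      using facts(5)[OF I] near_view[OF I] by (auto simp: degree_def fun_eq_iff)
  qed simp
  then have "common \<I> B (Suc (Suc (Suc (Suc 0))) + 2)
      (\<lambda>I. ((r I, eligible I, \<lambda>i. if i \<in> eligible I then degree I i else 0), digit1 I))"
  proof (rule common_best[where N = "2 * n" and W = "n ^ 3" and
      w = "\<lambda>V (r, E, dg) x. let F = all_facilities V in
        \<Sum>y\<in>F. \<Sum>z\<in>F. load_view F r E dg V (family F (x, y, z))"])
    show "card (nodes I) = 2 * n" if "I \<in> \<I>" for I by (rule card_nodes[OF that])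
    show "n ^ 3 + 1 \<le> 2 ^ B" "2 * n * n ^ 3 + 1 \<le> 2 ^ B" by (rule n3 B)+
    show "(\<lambda>(r, E, dg) x. let F = all_facilities (initial_view I u) in
        \<Sum>y\<in>F. \<Sum>z\<in>F. load_view F r E dg (initial_view I u) (family F (x, y, z)))
        (r I, eligible I, \<lambda>i. if i \<in> eligible I then degree I i else 0) x \<le> n ^ 3"
      if I: "I \<in> \<I>" "u \<in> nodes I" "x \<in> facilities I" for I u x
    proof -
      have "(\<Sum>y\<in>facilities I. \<Sum>z\<in>facilities I. load_view (facilities I) (r I) (eligible I)
          (\<lambda>i. if i \<in> eligible I then degree I i else 0) (initial_view I u) (family (facilities I) (x, y, z)))
          \<le> (\<Sum>y\<in>facilities I. \<Sum>z\<in>facilities I. n)"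
        by (intro sum_mono load_view_le I)
      then show ?thesis using facts[OF I(1)] by (simp add: Let_def power3_eq_cube)
    qed
    show "((r I, eligible I, \<lambda>i. if i \<in> eligible I then degree I i else 0), digit1 I) =
        ((r I, eligible I, \<lambda>i. if i \<in> eligible I then degree I i else 0),
        best (\<lambda>x. \<Sum>u\<in>nodes I. (\<lambda>(r, E, dg) x. let F = all_facilities (initial_view I u) in
          \<Sum>y\<in>F. \<Sum>z\<in>F. load_view F r E dg (initial_view I u) (family F (x, y, z)))
        (r I, eligible I, \<lambda>i. if i \<in> eligible I then degree I i else 0) x) (facilities I))"
      if I: "I \<in> \<I>" for I
      using facts[OF I] by (simp add: Let_def nodes_sum load_view[OF I] digit1_def)
  qed
  then have "common \<I> B (Suc (Suc (Suc (Suc 0))) + 2 + 2)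
      (\<lambda>I. (((r I, eligible I, \<lambda>i. if i \<in> eligible I then degree I i else 0), digit1 I), digit2 I))"
  proof (rule common_best[where N = "2 * n" and W = "n ^ 3" and
      w = "\<lambda>V ((r, E, dg), x) y. let F = all_facilities V in
        \<Sum>z\<in>F. load_view F r E dg V (family F (x, y, z))"])
    show "card (nodes I) = 2 * n" if "I \<in> \<I>" for I by (rule card_nodes[OF that])
    show "n ^ 3 + 1 \<le> 2 ^ B" "2 * n * n ^ 3 + 1 \<le> 2 ^ B" by (rule n3 B)+
    show "(\<lambda>((r, E, dg), x) y. let F = all_facilities (initial_view I u) in
        \<Sum>z\<in>F. load_view F r E dg (initial_view I u) (family F (x, y, z)))
        ((r I, eligible I, \<lambda>i. if i \<in> eligible I then degree I i else 0), digit1 I) y \<le> n ^ 3"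
      if I: "I \<in> \<I>" "u \<in> nodes I" "y \<in> facilities I" for I u y
    proof -
      have "(\<Sum>z\<in>facilities I. load_view (facilities I) (r I) (eligible I)
          (\<lambda>i. if i \<in> eligible I then degree I i else 0) (initial_view I u) (family (facilities I) (digit1 I, y, z)))
          \<le> (\<Sum>z\<in>facilities I. n)"
        by (intro sum_mono load_view_le I)
      also have "\<dots> \<le> n ^ 3" using facts[OF I(1)] n by (simp add: power3_eq_cube)
      finally show ?thesis by (simp add: Let_def)
    qed
    show "(((r I, eligible I, \<lambda>i. if i \<in> eligible I then degree I i else 0), digit1 I), digit2 I) =
        (((r I, eligible I, \<lambda>i. if i \<in> eligible I then degree I i else 0), digit1 I),
        best (\<lambda>y. \<Sum>u\<in>nodes I. (\<lambda>((r, E, dg), x) y. let F = all_facilities (initial_view I u) in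
          \<Sum>z\<in>F. load_view F r E dg (initial_view I u) (family F (x, y, z)))
        ((r I, eligible I, \<lambda>i. if i \<in> eligible I then degree I i else 0), digit1 I) y) (facilities I))"
      if I: "I \<in> \<I>" for I
      using facts[OF I] by (simp add: Let_def nodes_sum load_view[OF I] digit2_def)
  qed
  then have "common \<I> B (Suc (Suc (Suc (Suc 0))) + 2 + 2 + 2)
      (\<lambda>I. ((((r I, eligible I, \<lambda>i. if i \<in> eligible I then degree I i else 0), digit1 I), digit2 I), digit3 I))"
  proof (rule common_best[where N = "2 * n" and W = "n ^ 3" and
      w = "\<lambda>V (((r, E, dg), x), y) z. let F = all_facilities V in load_view F r E dg V (family F (x, y, z))"])
    show "card (nodes I) = 2 * n" if "I \<in> \<I>" for I by (rule card_nodes[OF that])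
    show "n ^ 3 + 1 \<le> 2 ^ B" "2 * n * n ^ 3 + 1 \<le> 2 ^ B" by (rule n3 B)+
    show "(\<lambda>(((r, E, dg), x), y) z. let F = all_facilities (initial_view I u) in
        load_view F r E dg (initial_view I u) (family F (x, y, z)))
        (((r I, eligible I, \<lambda>i. if i \<in> eligible I then degree I i else 0), digit1 I), digit2 I) z \<le> n ^ 3"
      if I: "I \<in> \<I>" "u \<in> nodes I" "z \<in> facilities I" for I u z
      using load_view_le[OF I(1,2)] self_le_power[OF n, of 3] by (simp add: Let_def) (meson order_trans)
    show "((((r I, eligible I, \<lambda>i. if i \<in> eligible I then degree I i else 0), digit1 I), digit2 I), digit3 I) =
        ((((r I, eligible I, \<lambda>i. if i \<in> eligible I then degree I i else 0), digit1 I), digit2 I),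
        best (\<lambda>z. \<Sum>u\<in>nodes I. (\<lambda>(((r, E, dg), x), y) z. let F = all_facilities (initial_view I u) in
          load_view F r E dg (initial_view I u) (family F (x, y, z)))
        (((r I, eligible I, \<lambda>i. if i \<in> eligible I then degree I i else 0), digit1 I), digit2 I) z) (facilities I))"
      if I: "I \<in> \<I>" for I
      using facts[OF I] by (simp add: Let_def nodes_sum load_view[OF I] digit3_def)
  qed
  \<comment> \<open>No round is spent here: radii, degrees and digits are common, so every node
    evaluates the sample itself.\<close>
  from common_network[OF this]
  have "common \<I> B (Suc (Suc (Suc (Suc 0))) + 2 + 2 + 2) (\<lambda>I. (r I, eligible I, sampled I (chosen I)))"
    by (rule common_mono[where \<phi> = "\<lambda>((F, C), (((r, E, dg), x), y), z).
        (r, E, sample (2 * card F) E dg (family F (x, y, z)))"])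
      (auto simp: sample_def sampled_def chosen_def)
  \<comment> \<open>Whether a ball misses the sample is seen from the row of its centre, and one bit
    announces it.\<close>
  then have "common \<I> B (Suc (Suc (Suc (Suc (Suc 0))) + 2 + 2 + 2)) (\<lambda>I. (r I, eligible I, core I))"
  proof (rule common_broadcast'[where Q = UNIV and
      \<phi> = "\<lambda>F (r, E, X) y. (r, E, {i \<in> F. y (Inl i)})" and
      x = "\<lambda>V (r, E, X). case self V of Inl i \<Rightarrow> i \<in> E \<and> (i \<in> X \<or> near_view 8 r E V i \<inter> X = {})
        | Inr j \<Rightarrow> False"])
    show "(r I, eligible I, core I) = (\<lambda>F (r, E, X) y. (r, E, {i \<in> F. y (Inl i)})) (facilities I)
        (r I, eligible I, sampled I (chosen I)) (restrict (\<lambda>u. (\<lambda>V (r, E, X). case self V of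
          Inl i \<Rightarrow> i \<in> E \<and> (i \<in> X \<or> near_view 8 r E V i \<inter> X = {}) | Inr j \<Rightarrow> False)
        (initial_view I u) (r I, eligible I, sampled I (chosen I))) (nodes I))"
      if I: "I \<in> \<I>" for I
      using facts(5)[OF I] near_view[OF I] by (auto simp: core_def kept_def)
  qed (use bool in auto)
  have core_sub: "core I \<subseteq> facilities I" if "I \<in> \<I>" for I
    using facts(5)[OF that] flp_context.core_sub[OF ctx[OF that]] by blast
  define a where "a = (\<lambda>I i. if i \<in> core I then card (near 2 I i \<inter> core I) else 0)"
  have "common \<I> B (Suc (Suc (Suc (Suc (Suc (Suc 0))) + 2 + 2 + 2))) (\<lambda>I. (r I, eligible I, core I, a I))"
    using \<open>common \<I> B _ (\<lambda>I. (r I, eligible I, core I))\<close>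
  proof (rule common_broadcast'[where Q = "{..n}" and
      \<phi> = "\<lambda>F (r, E, K) y. (r, E, K, \<lambda>i. if i \<in> K then y (Inl i) else 0)" and
      x = "\<lambda>V (r, E, K). case self V of Inl i \<Rightarrow> card (near_view 2 r E V i \<inter> K) | Inr j \<Rightarrow> 0"])
    show "card {..n} \<le> 2 ^ B" using B(3) by simp
    show "(\<lambda>(r, E, K). case self (initial_view I u) of Inl i \<Rightarrow> card (near_view 2 r E (initial_view I u) i \<inter> K)
        | Inr j \<Rightarrow> 0) (r I, eligible I, core I) \<in> {..n}" if I: "I \<in> \<I>" and u: "u \<in> nodes I" for I u
      using near_view[OF I] card_near[OF I] u by (auto split: sum.split)
    show "(r I, eligible I, core I, a I) =
        (\<lambda>F (r, E, K) y. (r, E, K, \<lambda>i. if i \<in> K then y (Inl i) else 0)) (facilities I)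
        (r I, eligible I, core I) (restrict (\<lambda>u. (\<lambda>V (r, E, K). case self V of
          Inl i \<Rightarrow> card (near_view 2 r E V i \<inter> K) | Inr j \<Rightarrow> 0)
        (initial_view I u) (r I, eligible I, core I)) (nodes I))"
      if I: "I \<in> \<I>" for I
      using core_sub[OF I] near_view[OF I] by (auto simp: a_def fun_eq_iff)
  qed simp
  note known = common_network[OF this]

  define A where "A = (\<lambda>I i. near 2 I i \<inter> core I)"
  \<comment> \<open>The edges collected by facility \<open>f\<close>: indices are below
    \<open>77 * n\<close> and there are \<open>n\<close> classes, so each gets at most 77 edges, a
    set that fits into one message.\<close>
  define part where "part = (\<lambda>I f. {p \<in> Sigma (core I) (A I).
    (\<lambda>(i, u). index_of (core I) (a I) (A I i) i u) p mod n = facility_number (facilities I) f})"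
  have part: "card (part I f) \<le> 77" "finite (part I f)" "part I f \<subseteq> {..<2 * n} \<times> {..<2 * n}"
    if I: "I \<in> \<I>" for I f
  proof -
    interpret flp_context n I by (rule ctx[OF I])
    have fin: "finite (Sigma (core I) (A I))" by (simp add: A_def)
    have idx: "inj_on (\<lambda>(i, u). index_of (core I) (a I) (A I i) i u) (Sigma (core I) (A I))"
      "(\<lambda>(i, u). index_of (core I) (a I) (A I i) i u) ` Sigma (core I) (A I) \<subseteq> {..<\<Sum>i\<in>core I. a I i}"
      by (rule index_of; simp add: A_def a_def)+
    have "(\<Sum>i\<in>core I. a I i) \<le> 77 * n"
      using sum_core_degree[OF n] by (simp add: a_def)
    then have "(\<lambda>(i, u). index_of (core I) (a I) (A I i) i u) ` Sigma (core I) (A I) \<subseteq> {..<77 * n}"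
      using idx(2) by fastforce
    from card_mod_class_le[OF idx(1) this, of "facility_number F f"] n
    show "card (part I f) \<le> 77" by (simp add: part_def)
    show "finite (part I f)" using fin by (rule rev_finite_subset) (auto simp: part_def)
    have "core I \<subseteq> {..<2 * n}" using core_sub E_sub F_sub by blast
    then show "part I f \<subseteq> {..<2 * n} \<times> {..<2 * n}" by (auto simp: part_def A_def)
  qed
  \<comment> \<open>Node \<open>i\<close> names only the far endpoints of its edges; the near one is
    the sender, from which \<open>y\<close> restores the pairs.\<close>
  define x where "x = (\<lambda>V p (v :: node). case p of ((F, C :: nat set), r :: nat \<Rightarrow> real, E, K, a) \<Rightarrow>
    (case (self V, v) of (Inl i, Inl f) \<Rightarrow>
      if i \<in> K then {u \<in> near_view 2 r E V i \<inter> K.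
        index_of K a (near_view 2 r E V i \<inter> K) i u mod card F = facility_number F f} else {} | _ \<Rightarrow> {}))"
  define y where "y = (\<lambda>p z. case p of ((F :: nat set, C :: nat set), r :: nat \<Rightarrow> real, E :: nat set, K, a :: nat \<Rightarrow> nat) \<Rightarrow>
    Sigma K (\<lambda>i :: nat. z (Inl i :: node) :: nat set))"
  define G where "G = (\<lambda>I. ((facilities I, clients I), r I, eligible I, core I, a I))"
  have x: "x (initial_view I u) (G I) v = (case (u, v) of (Inl i, Inl f) \<Rightarrow> {w. (i, w) \<in> part I f} | _ \<Rightarrow> {})"
    if I: "I \<in> \<I>" "u \<in> nodes I" for I u v
    using near_view[OF I(1)] I facts[OF I(1)]
    by (auto simp: x_def G_def part_def A_def split: sum.split)
  have y: "y (G I) (restrict (\<lambda>u. x (initial_view I u) (G I) v) (nodes I)) =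
      (case v of Inl f \<Rightarrow> part I f | Inr j \<Rightarrow> {})" if I: "I \<in> \<I>" for I v
    using core_sub[OF I] x[OF I]
    by (auto simp: y_def G_def part_def subset_iff split: sum.split)
  have "common \<I> B (Suc (Suc (Suc (Suc (Suc (Suc 0))) + 2 + 2 + 2)) + 2) (\<lambda>I. (G I,
      restrict (\<lambda>v. y (G I) (restrict (\<lambda>u. x (initial_view I u) (G I) v) (nodes I))) (nodes I)))"
    (is "common _ _ ?R _")
  proof (rule common_relay[where Q = "{A. A \<subseteq> {..<2 * n} \<and> card A \<le> 77}" and
      Q' = "{A. A \<subseteq> {..<2 * n} \<times> {..<2 * n} \<and> card A \<le> 77}"])
    show "common \<I> B (Suc (Suc (Suc (Suc (Suc (Suc 0))) + 2 + 2 + 2))) G"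
      unfolding G_def by (rule known)
    show "finite {A. A \<subseteq> {..<2 * n} \<and> card A \<le> 77}"
      "finite {A. A \<subseteq> {..<2 * n} \<times> {..<2 * n} \<and> card A \<le> 77}"
      by (rule card_bounded_subsets; simp)+
    show "card {A. A \<subseteq> {..<2 * n} \<and> card A \<le> 77} \<le> 2 ^ B"
      using card_bounded_subsets(2)[of "{..<2 * n}" 77] B(5) by simp
    show "card {A. A \<subseteq> {..<2 * n} \<times> {..<2 * n} \<and> card A \<le> 77} \<le> 2 ^ B"
      using card_bounded_subsets(2)[of "{..<2 * n} \<times> {..<2 * n}" 77] B(6)
      by (simp add: card_cartesian_product)
    show "x (initial_view I u) (G I) v \<in> {A. A \<subseteq> {..<2 * n} \<and> card A \<le> 77}"
      if I: "I \<in> \<I>" "u \<in> nodes I" for I u v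
    proof -
      have "{w. (i, w) \<in> part I f} \<subseteq> {..<2 * n} \<and> card {w. (i, w) \<in> part I f} \<le> 77" for i f
      proof
        show "{w. (i, w) \<in> part I f} \<subseteq> {..<2 * n}" using part(3)[OF I(1), of f] by auto
        have "card {w. (i, w) \<in> part I f} \<le> card (part I f)"
          using part(2)[OF I(1), of f] by (intro card_inj_on_le[where f = "Pair i"]) (auto simp: inj_on_def)
        then show "card {w. (i, w) \<in> part I f} \<le> 77" using part(1)[OF I(1), of f] by linarith
      qed
      then show ?thesis unfolding x[OF I] by (simp split: sum.split)
    qed
    show "y (G I) (restrict (\<lambda>u. x (initial_view I u) (G I) v) (nodes I)) \<in>
        {A. A \<subseteq> {..<2 * n} \<times> {..<2 * n} \<and> card A \<le> 77}" if I: "I \<in> \<I>" for I v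
      unfolding y[OF I] using part[OF I] by (simp split: sum.split)
  qed
  then have "common \<I> B ?R opened"
  proof (rule common_mono[where \<phi> = "\<lambda>(((F, C), r, E, K, a), t). mis K (\<Union>f\<in>F. t (Inl f))"])
    fix I assume I: "I \<in> \<I>"
    \<comment> \<open>Every residue is the number of some facility, so no edge of the core is
      lost.\<close>
    have "p \<in> (\<Union>f\<in>facilities I. part I f)" if p: "p \<in> core_rel I" for p
    proof -
      obtain i u where iu: "p = (i, u)" by (cases p)
      have "index_of (core I) (a I) (A I i) i u mod n < n" using n by simp
      then have "index_of (core I) (a I) (A I i) i u mod n \<in> facility_number (facilities I) ` facilities I"
        using facility_number[of "facilities I"] facts[OF I] by (auto simp: bij_betw_def)
      then show ?thesis using p by (auto simp: iu part_def core_rel_def A_def)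
    qed
    then have "core_rel I = (\<Union>f\<in>facilities I. part I f)"
      by (auto simp: part_def core_rel_def A_def)
    then show "opened I = (\<lambda>(((F, C), r, E, K, a), t). mis K (\<Union>f\<in>F. t (Inl f)))
        (G I, restrict (\<lambda>v. y (G I) (restrict (\<lambda>u. x (initial_view I u) (G I) v) (nodes I))) (nodes I))"
      by (simp add: y[OF I]) (simp add: G_def opened_def)
  qed
  then have "computable \<I> B ?R (\<lambda>I v. case v of Inl i \<Rightarrow> i \<in> opened I
    | Inr j \<Rightarrow> dist_to_set I j (opened I) \<le> ereal (penalty I j))"
    unfolding common_def
  proof (rule computable_mono[where \<phi> = "\<lambda>(V, S). case self V of Inl i \<Rightarrow> i \<in> S
      | Inr j \<Rightarrow> (INF i\<in>S. ereal (row V i)) \<le> ereal (weight V)"])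
    fix I v assume I: "I \<in> \<I>" and v: "v \<in> nodes I"
    have "opened I \<subseteq> facilities I"
      using facts(5)[OF I] flp_context.opened_properties(1)[OF ctx[OF I]] by blast
    then have "(INF i\<in>opened I. ereal (row (initial_view I (Inr j)) i)) = dist_to_set I j (opened I)" for j
      unfolding dist_to_set_def by (intro INF_cong) auto
    then show "(case v of Inl i \<Rightarrow> i \<in> opened I | Inr j \<Rightarrow> dist_to_set I j (opened I) \<le> ereal (penalty I j)) =
        (\<lambda>(V, S). case self V of Inl i \<Rightarrow> i \<in> S | Inr j \<Rightarrow> (INF i\<in>S. ereal (row V i)) \<le> ereal (weight V))
          (initial_view I v, opened I)"
      by (simp split: sum.split)
  qed
  then show ?thesis by (simp add: eval_nat_numeral)
qed

lemma bit_length_bigo: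
  "(\<lambda>n. real (alphabet_bound (bits n) (nat \<lceil>log 2 (real n + 1)\<rceil>))) \<in> O(\<lambda>n. ln (real n))"
  if bits: "(\<lambda>n. real (bits n)) \<in> O(\<lambda>n. ln (real n))" for bits :: "nat \<Rightarrow> nat"
proof -
  have "(\<lambda>n. real (nat \<lceil>log 2 (real n + 1)\<rceil>)) \<in> O(\<lambda>n. log 2 (real n + 1) + 1)"
  proof (rule bigoI[where c = 1], rule eventuallyI)
    fix n :: nat
    have "0 \<le> log 2 (real n + 1)" by simp
    then have "real (nat \<lceil>log 2 (real n + 1)\<rceil>) \<le> log 2 (real n + 1) + 1" by linarith
    then show "norm (real (nat \<lceil>log 2 (real n + 1)\<rceil>)) \<le> 1 * norm (log 2 (real n + 1) + 1)"
      unfolding real_norm_def abs_of_nat mult_1 by (rule order_trans[OF _ abs_ge_self])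
  qed
  also have "(\<lambda>n. log 2 (real n + 1) + 1) \<in> O(\<lambda>n. ln (real n))" by real_asymp
  finally have 1: "(\<lambda>n. real (nat \<lceil>log 2 (real n + 1)\<rceil>)) \<in> O(\<lambda>n. ln (real n))" .
  have 2: "(\<lambda>n. 154 :: real) \<in> O(\<lambda>n. ln (real n))" by real_asymp
  have "(\<lambda>n. real (bits n) + (154 * real (nat \<lceil>log 2 (real n + 1)\<rceil>) + 154)) \<in> O(\<lambda>n. ln (real n))"
    using bits 1 2 by (intro sum_in_bigo) auto
  then show ?thesis by (simp add: alphabet_bound_def algebra_simps)
qed

text \<open>The constructed algorithm ignores its tapes and halts after 14 rounds on every input, so
  both the approximation and the running time hold for all tapes and the probability is 1 whatever
  \<open>c\<close> is.\<close>

theorem theorem58: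
  shows "\<exists>\<alpha>::real. \<forall>(bits :: nat \<Rightarrow> nat) (dec :: nat \<Rightarrow> bool list \<Rightarrow> real) (c :: nat).
    (\<lambda>n. real (bits n)) \<in> O(\<lambda>n. ln (real n)) \<longrightarrow>
    (\<exists>(A :: algorithm) (B :: nat \<Rightarrow> nat) (T :: nat \<Rightarrow> nat).
       (\<lambda>n. real (B n)) \<in> O(\<lambda>n. ln (real n)) \<and>
       (\<lambda>n. real (T n)) \<in> O(\<lambda>n. ln (ln (ln (real n)))) \<and>
       (\<forall>n\<ge>1. \<forall>I :: flp. flp_instance n I \<and> numbers_representable (dec n) (bits n) I \<longrightarrow>
          bandwidth_at_most A I (B n) \<and>
          approximates A I \<alpha> \<and>
          \<P>(\<omega> in tapes I. halted A I \<omega> (T n)) \<ge> 1 - 1 / real n ^ c))"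
proof (rule exI[of _ 45], intro allI impI)
  fix bits :: "nat \<Rightarrow> nat" and dec :: "nat \<Rightarrow> bool list \<Rightarrow> real" and c :: nat
  assume bits: "(\<lambda>n. real (bits n)) \<in> O(\<lambda>n. ln (real n))"
  define l where "l = (\<lambda>n. nat \<lceil>log 2 (real n + 1)\<rceil>)"
  define B where "B = (\<lambda>n. alphabet_bound (bits n) (l n))"
  define \<I> where "\<I> = (\<lambda>n. {I. flp_instance n I \<and> numbers_representable (dec n) (bits n) I})"
  define K where "K = (\<lambda>I v. case v of Inl i \<Rightarrow> i \<in> opened I
    | Inr j \<Rightarrow> dist_to_set I j (opened I) \<le> ereal (penalty I j))"
  have l: "n + 1 \<le> 2 ^ l n" for n
  proof -
    have "real n + 1 = 2 powr log 2 (real n + 1)" by simp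
    also have "\<dots> \<le> 2 powr real (l n)" by (intro powr_mono) (auto simp: l_def)
    finally have "real (n + 1) \<le> real (2 ^ l n)" by (simp add: powr_realpow)
    then show ?thesis by (simp only: of_nat_le_iff)
  qed
  have "\<exists>A. \<forall>n\<ge>1. \<forall>I\<in>\<I> n. bandwidth_at_most A I (B n) \<and>
    (\<forall>\<omega>. halted A I \<omega> 14 \<and> solution A I \<omega> 14 =
      ({j \<in> clients I. K I (Inr j)}, {i \<in> facilities I. K I (Inl i)}))"
  proof (rule algorithm_of_knowledge[where K = "\<lambda>n. K"])
    show "computable (\<I> n) (B n) 14 K" if "n \<ge> 1" for n
      unfolding \<I>_def B_def K_def by (rule computable_opened[OF that l])
    show "card (facilities I) = n" if "I \<in> \<I> n" for n I
      using that by (simp add: \<I>_def flp_instance_def)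
  qed
  then obtain A where A: "\<And>n I. n \<ge> 1 \<Longrightarrow> I \<in> \<I> n \<Longrightarrow> bandwidth_at_most A I (B n)"
    "\<And>n I \<omega>. n \<ge> 1 \<Longrightarrow> I \<in> \<I> n \<Longrightarrow> halted A I \<omega> 14"
    "\<And>n I \<omega>. n \<ge> 1 \<Longrightarrow> I \<in> \<I> n \<Longrightarrow> solution A I \<omega> 14 =
      ({j \<in> clients I. K I (Inr j)}, {i \<in> facilities I. K I (Inl i)})" by blast
  have "bandwidth_at_most A I (B n) \<and> approximates A I 45 \<and>
      \<P>(\<omega> in tapes I. halted A I \<omega> 14) \<ge> 1 - 1 / real n ^ c"
    if n: "n \<ge> 1" and I: "flp_instance n I \<and> numbers_representable (dec n) (bits n) I" for n I
  proof (intro conjI)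
    have I': "I \<in> \<I> n" using I by (simp add: \<I>_def)
    interpret flp_context n I using I by (simp add: flp_context_def)
    interpret tapes: prob_space "tapes I" by (rule prob_space_tapes)
    show "bandwidth_at_most A I (B n)" by (rule A(1)[OF n I'])
    have "{i \<in> F. K I (Inl i)} = opened I"
      using opened_properties(1) E_sub by (auto simp: K_def)
    then have "cost I (solution A I \<omega> 14) \<le> ereal 45 * min_cost I" for \<omega>
      using opened_cost A(3)[OF n I', of \<omega>] by (simp add: K_def)
    then show "approximates A I 45"
      using A(2)[OF n I'] by (auto simp: approximates_def)
    have "\<P>(\<omega> in tapes I. halted A I \<omega> 14) = 1"
      using A(2)[OF n I'] by (simp add: tapes.prob_space)
    then show "\<P>(\<omega> in tapes I. halted A I \<omega> 14) \<ge> 1 - 1 / real n ^ c" by simp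
  qed
  moreover have "(\<lambda>n. real (B n)) \<in> O(\<lambda>n. ln (real n))"
    unfolding B_def l_def by (rule bit_length_bigo[OF bits])
  \<comment> \<open>The iterated logarithm tends to infinity and hence dominates any
    constant.\<close>
  moreover have "(\<lambda>n. real 14) \<in> O(\<lambda>n. ln (ln (ln (real n))))" by simp real_asymp
  ultimately show "\<exists>(A :: algorithm) (B :: nat \<Rightarrow> nat) (T :: nat \<Rightarrow> nat).
       (\<lambda>n. real (B n)) \<in> O(\<lambda>n. ln (real n)) \<and>
       (\<lambda>n. real (T n)) \<in> O(\<lambda>n. ln (ln (ln (real n)))) \<and>
       (\<forall>n\<ge>1. \<forall>I :: flp. flp_instance n I \<and> numbers_representable (dec n) (bits n) I \<longrightarrow>
          bandwidth_at_most A I (B n) \<and> approximates A I 45 \<and>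
          \<P>(\<omega> in tapes I. halted A I \<omega> (T n)) \<ge> 1 - 1 / real n ^ c)"
    by (intro exI[of _ A] exI[of _ B] exI[of _ "\<lambda>n. 14"]) auto
qed

end
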